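(* The following $m$-equivalences between two-element sets of patterns of length three hold: (1) $\{111,123\}\sim\{111,132\}\sim\{111,213\}$; (2) $\{111,112\}\sim\{111,121\}$; (3) $\{112,123\}\sim\{112,213\}\sim\{121,132\}$; (4) $\{112,212\}\sim\{121,122\}$; (5) $\{121,123\}\sim\{121,213\}$. Moreover, this list is complete up to symmetry: on the collection of all sets consisting of two distinct patterns of length three, $m$-equivalence $\sim$ is the smallest equivalence relation $\approx$ that contains all the relations listed in (1)--(5), satisfies $P\approx P^r$ for every $P$, and is such that $P\approx Q$ implies $P^c\approx Q^c$.
   Context: A (finite, reduced) multiset is $S=1^{a_1}2^{a_2}\cdots k^{a_k}$ with $k\ge 1$ and all $a_i\ge 1$, meaning that $i$ occurs with multiplicity $a_i$. A multipermutation of $S$ is a word having exactly $a_i$ occurrences of each letter $i\in[k]=\{1,\dots,k\}$ and no other letters. A word $\pi=\pi_1\cdots\pi_n$ contains a pattern (word) $\rho=\rho_1\cdots\rho_\ell$ if there are indices $i(1)<\cdots<i(\ell)$ such that for all $a,b\in[\ell]$: $\pi_{i(a)}<\pi_{i(b)}$ iff $\rho_a<\rho_b$, and $\pi_{i(a)}>\pi_{i(b)}$ iff $\rho_a>\rho_b$; otherwise $\pi$ avoids $\rho$. For a set $P$ of patterns, $\mathrm{av}(S;P)$ is the number of multipermutations of $S$ that avoid every pattern in $P$. Two sets of patterns $P,Q$ are $m$-equivalent, written here $P\sim Q$, if $\mathrm{av}(S;P)=\mathrm{av}(S;Q)$ for every multiset $S$. Patterns of length three are the multipermutations of size three of reduced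 multisets, i.e. the 13 words $111$; $112,121,211$; $122,212,221$; $123,132,213,231,312,321$. For a word $\pi=\pi_1\cdots\pi_n$ with maximum letter $k$, the reversal is $\pi^r=\pi_n\cdots\pi_1$ and the complement is $\pi^c=(k+1-\pi_1)\cdots(k+1-\pi_n)$; for a set $P$ of patterns, $P^r$ and $P^c$ are obtained by applying the operation to each pattern in $P$. *)

theory Defs
  imports "HOL-Combinatorics.Multiset_Permutations"
begin

type_synonym word = "nat list"

definition reduced :: "nat multiset \<Rightarrow> bool" where
  "reduced S \<longleftrightarrow> (\<exists>k\<ge>1. set_mset S = {1..k})"

definition contains_pattern :: "word \<Rightarrow> word \<Rightarrow> bool" where
  "contains_pattern \<pi> \<rho> \<longleftrightarrow>
     (\<exists>i :: nat \<Rightarrow> nat. strict_mono_on {..<length \<rho>} i \<and> i ` {..<length \<rho>} \<subseteq> {..<length \<pi>} \<and>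
        (\<forall>a<length \<rho>. \<forall>b<length \<rho>.
           (\<pi> ! i a < \<pi> ! i b \<longleftrightarrow> \<rho> ! a < \<rho> ! b) \<and>
           (\<pi> ! i a > \<pi> ! i b \<longleftrightarrow> \<rho> ! a > \<rho> ! b)))"

abbreviation avoids :: "word \<Rightarrow> word \<Rightarrow> bool" where
  "avoids \<pi> \<rho> \<equiv> \<not> contains_pattern \<pi> \<rho>"

definition av :: "nat multiset \<Rightarrow> word set \<Rightarrow> nat" where
  "av S P = card {\<pi> \<in> permutations_of_multiset S. \<forall>\<rho>\<in>P. avoids \<pi> \<rho>}"

definition m_equivalent :: "word set \<Rightarrow> word set \<Rightarrow> bool"  (infix \<open>\<sim>\<^sub>m\<close> 50) where
  "P \<sim>\<^sub>m Q \<longleftrightarrow> (\<forall>S. reduced S \<longrightarrow> av S P = av S Q)"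

definition patterns3 :: "word set" where
  "patterns3 = {\<rho>. \<exists>S. reduced S \<and> size S = 3 \<and> \<rho> \<in> permutations_of_multiset S}"

definition pattern_pairs :: "word set set" where
  "pattern_pairs = {P. P \<subseteq> patterns3 \<and> card P = 2}"

definition complement :: "word \<Rightarrow> word" where
  "complement \<pi> = map (\<lambda>x. Max (set \<pi>) + 1 - x) \<pi>"

definition listed_relations :: "(word set \<times> word set) set" where
  "listed_relations =
    {({[1,1,1], [1,2,3]}, {[1,1,1], [1,3,2]}),
     ({[1,1,1], [1,3,2]}, {[1,1,1], [2,1,3]}),
     ({[1,1,1], [1,1,2]}, {[1,1,1], [1,2,1]}),
     ({[1,1,2], [1,2,3]}, {[1,1,2], [2,1,3]}),
     ({[1,1,2], [2,1,3]}, {[1,2,1], [1,3,2]}),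
     ({[1,1,2], [2,1,2]}, {[1,2,1], [1,2,2]}),
     ({[1,2,1], [1,2,3]}, {[1,2,1], [2,1,3]})}"

definition admissible :: "(word set \<times> word set) set \<Rightarrow> bool" where
  "admissible R \<longleftrightarrow>
     equiv pattern_pairs R \<and>
     listed_relations \<subseteq> R \<and>
     (\<forall>P\<in>pattern_pairs. (P, rev ` P) \<in> R) \<and>
     (\<forall>P Q. (P, Q) \<in> R \<longrightarrow> (complement ` P, complement ` Q) \<in> R)"

definition m_equivalence_on_pairs :: "(word set \<times> word set) set" where
  "m_equivalence_on_pairs = {(P, Q). P \<in> pattern_pairs \<and> Q \<in> pattern_pairs \<and> P \<sim>\<^sub>m Q}"

end

theory Submission
  imports Defs "HOL-Library.Sublist"
begin

text \<open>
  Avoiding \<open>123\<close> means that after every letter \<open>x\<close> the letters larger than \<open>x\<close> decrease weakly, and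
  avoiding \<open>132\<close> that they increase weakly. Removing the first letter of a word gives the same
  recursion for both counts: only the number of letters that are already forced to be sorted
  matters, not the direction of sorting. The same argument, with ``at least \<open>x\<close>'' for ``larger than
  \<open>x\<close>'' or with strict monotonicity, handles \<open>{112,123} \<sim> {121,132}\<close> and \<open>{122,123} \<sim> {122,132}\<close>; the
  reverse complement turns \<open>132\<close> into \<open>213\<close>. Avoiding \<open>111\<close> only restricts the multiset.

  The remaining equivalences use isomorphic generating trees. When all copies of the smallest letter
  are inserted at once, avoiding \<open>121\<close> forces these copies to be adjacent, and avoiding \<open>112\<close> forces
  all but the first of them to the end of the word, so that one position determines the insertion.
  The number of admissible positions before an insertion determines the multiset of numbers of
  admissible positions after it, in the same way for both sides of the equivalence.

  Inequivalent classes are told apart by the numbers of avoiders for three multisets of size five.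
\<close>


text \<open>The obstacle in the first-letter recursion is that the two sides consume different
  letters: among the letters already forced to be sorted, the next one is the smallest for one
  direction and the largest for the other. A common multiset therefore does not survive the
  induction. Instead, two multisets are compared that agree only outside the forced letters. The
  forced letters always form an upper set, so a further letter below them merely enlarges it, and a
  single predicate records the whole past.

  In the generating trees the positions themselves do not correspond, only their numbers do. Each
  side picks its own enumeration of the positions, from the left or from the right, so that one
  formula covers both.

  For completeness, the list and the symmetries connect each of the 78 pairs to one of 32
  representatives. Each of the three multisets contributes: {112,312} differs from {112,212} only in
  the first count and from {112,321} only in the second, and {112,121} differs from {112,211} only
  in the third.\<close>

section \<open>Patterns as subsequences\<close>

text \<open>One direction of comparison suffices: exchanging \<open>a\<close> and \<open>b\<close>
  yields the other, and equality is what remains.\<close>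

definition same_order :: "word \<Rightarrow> word \<Rightarrow> bool" where
  "same_order u \<rho> \<longleftrightarrow>
     length u = length \<rho> \<and> (\<forall>a<length \<rho>. \<forall>b<length \<rho>. u ! a < u ! b \<longleftrightarrow> \<rho> ! a < \<rho> ! b)"

text \<open>The induction removes the largest index \<open>j\<close>; the smaller ones then live in
  the prefix \<open>take j w\<close>, which is why the statement is about prefixes.\<close>

lemma subseq_map_nth:
  assumes "sorted_wrt (<) is" "set is \<subseteq> {..<n}" "n \<le> length w"
  shows "subseq (map ((!) w) is) (take n w)"
  using assms
proof (induction "is" arbitrary: n rule: rev_induct)
  case (snoc j js)
  have j: "j < n" "j < length w"
    using snoc.prems by auto
  have "subseq (map ((!) w) js) (take j w)"
    using snoc.prems j by (intro snoc.IH) (auto simp: sorted_wrt_append)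
  then have "subseq (map ((!) w) (js @ [j])) (take (Suc j) w)"
    using j by (simp add: take_Suc_conv_app_nth)
  moreover have "subseq (take (Suc j) w) (take n w)"
    using prefix_imp_subseq[OF take_is_prefix[of "Suc j" "take n w"]] j by (simp add: min_absorb1)
  ultimately show ?case
    by (rule subseq_order.order_trans)
qed simp

lemma subseq_imp_strict_mono_index:
  assumes "subseq u w"
  shows "\<exists>i::nat \<Rightarrow> nat. strict_mono_on {..<length u} i \<and>
           (\<forall>a<length u. i a < length w \<and> w ! i a = u ! a)"
  using assms
proof (induction rule: list_emb.induct)
  case (list_emb_Nil w)
  then show ?case by (auto simp: strict_mono_on_def)
next
  case (list_emb_Cons u w x)
  then obtain i :: "nat \<Rightarrow> nat" where i: "strict_mono_on {..<length u} i"
    "\<forall>a<length u. i a < length w \<and> w ! i a = u ! a" by blast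
  show ?case
    by (rule exI[of _ "\<lambda>a. Suc (i a)"]) (use i in \<open>auto simp: strict_mono_on_def\<close>)
next
  case (list_emb_Cons2 x y u w)
  then obtain i :: "nat \<Rightarrow> nat" where i: "strict_mono_on {..<length u} i"
    "\<forall>a<length u. i a < length w \<and> w ! i a = u ! a" by blast
  show ?case
    by (rule exI[of _ "\<lambda>a. case a of 0 \<Rightarrow> 0 | Suc b \<Rightarrow> Suc (i b)"])
      (use i list_emb_Cons2.hyps in \<open>auto simp: strict_mono_on_def less_Suc_eq_0_disj split: nat.splits\<close>)
qed

text \<open>From here on occurrences are subsequences, so that recursion on words replaces reasoning
  with index functions.\<close>

lemma contains_pattern_iff_subseq:
  "contains_pattern w \<rho> \<longleftrightarrow> (\<exists>u. subseq u w \<and> same_order u \<rho>)"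
proof
  assume "contains_pattern w \<rho>"
  then obtain i :: "nat \<Rightarrow> nat" where i: "strict_mono_on {..<length \<rho>} i"
    "i ` {..<length \<rho>} \<subseteq> {..<length w}"
    and order: "\<forall>a<length \<rho>. \<forall>b<length \<rho>. (w ! i a < w ! i b \<longleftrightarrow> \<rho> ! a < \<rho> ! b) \<and>
       (w ! i a > w ! i b \<longleftrightarrow> \<rho> ! a > \<rho> ! b)"
    unfolding contains_pattern_def by (elim exE conjE)
  let ?is = "map i [0..<length \<rho>]"
  have "subseq (map ((!) w) ?is) (take (length w) w)"
    using i by (intro subseq_map_nth)
      (auto simp: sorted_wrt_map sorted_wrt_iff_nth_less strict_mono_on_def image_subset_iff)
  moreover have "same_order (map ((!) w) ?is) \<rho>"
    using order by (simp add: same_order_def)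
  ultimately show "\<exists>u. subseq u w \<and> same_order u \<rho>"
    by auto
next
  assume "\<exists>u. subseq u w \<and> same_order u \<rho>"
  then obtain u where u: "subseq u w" "same_order u \<rho>" by blast
  from subseq_imp_strict_mono_index[OF u(1)]
  obtain i :: "nat \<Rightarrow> nat" where i: "strict_mono_on {..<length u} i"
    "\<forall>a<length u. i a < length w \<and> w ! i a = u ! a"
    by (elim exE conjE)
  note i(1)
  moreover have "i ` {..<length u} \<subseteq> {..<length w}"
    using i(2) by auto
  ultimately show "contains_pattern w \<rho>"
    using u(2) i(2) unfolding contains_pattern_def same_order_def by (intro exI[of _ i]) simp
qed

lemma same_order_length3:
  "same_order u [p, q, r] \<longleftrightarrow>
     (\<exists>x y z. u = [x, y, z] \<and>
        (x < y \<longleftrightarrow> p < q) \<and> (y < x \<longleftrightarrow> q < p) \<and> (x < z \<longleftrightarrow> p < r) \<and>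
        (z < x \<longleftrightarrow> r < p) \<and> (y < z \<longleftrightarrow> q < r) \<and> (z < y \<longleftrightarrow> r < q))"
proof (cases "length u = 3")
  case True
  then obtain x y z where u: "u = [x, y, z]"
    by (auto simp: numeral_3_eq_3 length_Suc_conv)
  show ?thesis
    unfolding u same_order_def by (simp add: All_less_Suc numeral_3_eq_3) argo
next
  case False
  then show ?thesis
    by (auto simp: same_order_def)
qed

lemma contains_pattern_length3:
  "contains_pattern w [p, q, r] \<longleftrightarrow>
     (\<exists>x y z. subseq [x, y, z] w \<and>
        (x < y \<longleftrightarrow> p < q) \<and> (y < x \<longleftrightarrow> q < p) \<and> (x < z \<longleftrightarrow> p < r) \<and>
        (z < x \<longleftrightarrow> r < p) \<and> (y < z \<longleftrightarrow> q < r) \<and> (z < y \<longleftrightarrow> r < q))"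
  unfolding contains_pattern_iff_subseq same_order_length3 by blast


section \<open>Reversal and complement\<close>

lemma subseq_rev_iff: "subseq (rev u) (rev w) \<longleftrightarrow> subseq u w"
proof -
  have *: "subseq u w \<Longrightarrow> subseq (rev u) (rev w)" for u w :: "'a list"
    by (induction rule: list_emb.induct) (simp_all add: subseq_rev_drop_many)
  show ?thesis
    using *[of u w] *[of "rev u" "rev w"] by auto
qed

lemma same_order_rev:
  assumes "same_order u \<rho>"
  shows "same_order (rev u) (rev \<rho>)"
  using assms by (auto simp: same_order_def rev_nth)

lemma contains_pattern_rev:
  "contains_pattern (rev w) (rev \<rho>) \<longleftrightarrow> contains_pattern w \<rho>"
proof -
  have *: "contains_pattern w \<rho> \<Longrightarrow> contains_pattern (rev w) (rev \<rho>)" for w \<rho>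
    unfolding contains_pattern_iff_subseq using subseq_rev_iff same_order_rev by blast
  show ?thesis
    using *[of w \<rho>] *[of "rev w" "rev \<rho>"] by auto
qed

lemma av_rev: "av S (rev ` P) = av S P"
  unfolding av_def
proof (rule bij_betw_same_card)
  show "bij_betw rev {w \<in> permutations_of_multiset S. \<forall>\<rho>\<in>rev ` P. avoids w \<rho>}
          {w \<in> permutations_of_multiset S. \<forall>\<rho>\<in>P. avoids w \<rho>}"
    by (rule bij_betw_byWitness[of _ rev])
      (auto simp: permutations_of_multiset_def contains_pattern_rev,
       metis contains_pattern_rev rev_rev_ident)
qed

definition complement_multiset :: "nat multiset \<Rightarrow> nat multiset" where
  "complement_multiset S = {#Max (set_mset S) + 1 - x. x \<in># S#}"

lemma reducedE:
  assumes "reduced S"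
  obtains k where "k \<ge> 1" "set_mset S = {1..k}" "Max (set_mset S) = k"
proof -
  obtain k where "k \<ge> 1" "set_mset S = {1..k}"
    using assms unfolding reduced_def by blast
  then show thesis
    by (intro that[of k] Max_eqI) auto
qed

lemma complement_interval: "(-) (Suc k) ` {Suc 0..k} = {Suc 0..k}"
proof
  show "{Suc 0..k} \<subseteq> (-) (Suc k) ` {Suc 0..k}"
  proof
    fix x assume "x \<in> {Suc 0..k}"
    then show "x \<in> (-) (Suc k) ` {Suc 0..k}"
      by (intro image_eqI[of _ _ "Suc k - x"]) auto
  qed
qed auto

lemma reduced_complement_multiset: "reduced S \<Longrightarrow> reduced (complement_multiset S)"
  by (erule reducedE) (auto simp: reduced_def complement_multiset_def complement_interval)

lemma complement_multiset_involution:
  assumes "reduced S"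
  shows "complement_multiset (complement_multiset S) = S"
proof -
  obtain k where k: "k \<ge> 1" "set_mset S = {1..k}" "Max (set_mset S) = k"
    using assms by (rule reducedE)
  have "set_mset (complement_multiset S) = {1..k}"
    using k by (simp add: complement_multiset_def complement_interval)
  then have "complement_multiset (complement_multiset S) = {#k + 1 - (k + 1 - x). x \<in># S#}"
    using k unfolding complement_multiset_def by (simp add: multiset.map_comp o_def)
  also have "\<dots> = {#x. x \<in># S#}"
    using k(2) by (intro image_mset_cong) auto
  finally show ?thesis by simp
qed

lemma complement_perm:
  assumes "reduced S" "w \<in> permutations_of_multiset S"
  shows "complement w \<in> permutations_of_multiset (complement_multiset S)"
    and "complement (complement w) = w"
proof -
  obtain k where k: "k \<ge> 1" "set_mset S = {1..k}" "Max (set_mset S) = k"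
    using assms(1) by (rule reducedE)
  have w: "mset w = S" "set w = {1..k}"
    using assms(2) k by (auto simp: permutations_of_multiset_def simp flip: set_mset_mset)
  show "complement w \<in> permutations_of_multiset (complement_multiset S)"
    using w k by (simp add: permutations_of_multiset_def complement_multiset_def complement_def)
  have "set (complement w) = {1..k}"
    using w k by (simp add: complement_def complement_interval)
  then show "complement (complement w) = w"
    using w k unfolding complement_def by (auto intro!: map_idI)
qed

text \<open>The bound \<open>k\<close> will be the maximum of the surrounding word, which
  \<open>u\<close> itself may miss. So \<open>u\<close> and \<open>\<rho>\<close> are reflected
  about different centres, and only the reversal of the order matters.\<close>

lemma same_order_complement:
  assumes "same_order u \<rho>" "\<And>x. x \<in> set u \<Longrightarrow> x \<le> k"
  shows "same_order (map (\<lambda>x. k + 1 - x) u) (complement \<rho>)"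
  unfolding same_order_def
proof (intro conjI allI impI)
  show "length (map (\<lambda>x. k + 1 - x) u) = length (complement \<rho>)"
    using assms(1) by (simp add: same_order_def complement_def)
next
  fix a b
  assume "a < length (complement \<rho>)" "b < length (complement \<rho>)"
  then have ab: "a < length \<rho>" "b < length \<rho>" "a < length u" "b < length u"
    using assms(1) by (simp_all add: same_order_def complement_def)
  have *: "k + 1 - x < k + 1 - y \<longleftrightarrow> y < x" if "x \<le> k" "y \<le> k" for x y k :: nat
    using that by auto
  have "k + 1 - u ! a < k + 1 - u ! b \<longleftrightarrow> u ! b < u ! a"
    using ab assms(2) by (intro *) simp_all
  also have "\<dots> \<longleftrightarrow> \<rho> ! b < \<rho> ! a"
    using assms(1) ab by (simp add: same_order_def)
  also have "\<dots> \<longleftrightarrow> Max (set \<rho>) + 1 - \<rho> ! a < Max (set \<rho>) + 1 - \<rho> ! b"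
    using ab by (intro *[symmetric]) simp_all
  finally show "(map (\<lambda>x. k + 1 - x) u ! a < map (\<lambda>x. k + 1 - x) u ! b) =
      (complement \<rho> ! a < complement \<rho> ! b)"
    using ab by (simp add: complement_def)
qed

lemma contains_pattern_complement:
  assumes "contains_pattern w \<rho>"
  shows "contains_pattern (complement w) (complement \<rho>)"
proof -
  obtain u where u: "subseq u w" "same_order u \<rho>"
    using assms contains_pattern_iff_subseq by blast
  have "set u \<subseteq> set w"
    using u(1) set_nths_subset by (metis subseq_conv_nths)
  then have "same_order (map (\<lambda>x. Max (set w) + 1 - x) u) (complement \<rho>)"
    using u by (intro same_order_complement) auto
  then show ?thesis
    using subseq_map[OF u(1)] unfolding contains_pattern_iff_subseq complement_def by blast
qed

lemma complement_patterns:
  assumes "\<rho> \<in> patterns3"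
  shows "complement \<rho> \<in> patterns3" "complement (complement \<rho>) = \<rho>"
proof -
  obtain S where S: "reduced S" "size S = 3" "\<rho> \<in> permutations_of_multiset S"
    using assms unfolding patterns3_def by blast
  then have "size (complement_multiset S) = 3"
    by (simp add: complement_multiset_def)
  then show "complement \<rho> \<in> patterns3" "complement (complement \<rho>) = \<rho>"
    using S complement_perm reduced_complement_multiset unfolding patterns3_def by blast+
qed

text \<open>Unlike reversal, complementation moves the count to another multiset. Hence it does not
  make \<open>P\<close> equivalent to its complement, but it transports an equivalence between two
  sets, because it permutes the reduced multisets.\<close>

lemma av_complement:
  assumes S: "reduced S" and P: "P \<subseteq> patterns3"
  shows "av (complement_multiset S) (complement ` P) = av S P"
  unfolding av_def
proof (rule bij_betw_same_card)
  \<comment> \<open>Containment was transported in one direction only; complementing twice gives the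
    converse.\<close>
  have c: "contains_pattern (complement w) \<rho> \<longleftrightarrow> contains_pattern w (complement \<rho>)"
    if "reduced T" "w \<in> permutations_of_multiset T" "\<rho> \<in> P" for T w \<rho>
    using contains_pattern_complement[of "complement w" \<rho>]
      contains_pattern_complement[of w "complement \<rho>"]
      complement_perm(2)[OF that(1,2)] complement_patterns(2)[of \<rho>] that(3) P by auto
  have r: "reduced (complement_multiset S)"
    using S by (rule reduced_complement_multiset)
  have "complement w \<in> permutations_of_multiset S"
    if "w \<in> permutations_of_multiset (complement_multiset S)" for w
    using complement_perm(1)[OF r that] complement_multiset_involution[OF S] by simp
  note perm = this complement_perm[OF S] complement_perm(2)[OF r]
  show "bij_betw complement
     {w \<in> permutations_of_multiset (complement_multiset S). \<forall>\<rho>\<in>complement ` P. avoids w \<rho>}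
     {w \<in> permutations_of_multiset S. \<forall>\<rho>\<in>P. avoids w \<rho>}"
  proof (rule bij_betw_byWitness[of _ complement])
    have "avoids (complement w) (complement \<rho>)"
      if "w \<in> permutations_of_multiset S" "\<forall>\<rho>\<in>P. avoids w \<rho>" "\<rho> \<in> P" for w \<rho>
      using c[OF r perm(2)] perm(3) that by simp
    then show "complement ` {w \<in> permutations_of_multiset S. \<forall>\<rho>\<in>P. avoids w \<rho>} \<subseteq>
        {w \<in> permutations_of_multiset (complement_multiset S). \<forall>\<rho>\<in>complement ` P. avoids w \<rho>}"
      using perm(2) by blast
    have "avoids (complement w) \<rho>"
      if "w \<in> permutations_of_multiset (complement_multiset S)"
        "\<forall>\<rho>\<in>complement ` P. avoids w \<rho>" "\<rho> \<in> P" for w \<rho>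
      using c[OF r that(1,3)] that(2,3) by blast
    then show "complement ` {w \<in> permutations_of_multiset (complement_multiset S).
          \<forall>\<rho>\<in>complement ` P. avoids w \<rho>} \<subseteq>
        {w \<in> permutations_of_multiset S. \<forall>\<rho>\<in>P. avoids w \<rho>}"
      using perm(1) by blast
  next
    show "\<forall>w\<in>{w \<in> permutations_of_multiset (complement_multiset S).
        \<forall>\<rho>\<in>complement ` P. avoids w \<rho>}. complement (complement w) = w"
      using perm(4) by blast
    show "\<forall>w\<in>{w \<in> permutations_of_multiset S. \<forall>\<rho>\<in>P. avoids w \<rho>}.
        complement (complement w) = w"
      using perm(3) by blast
  qed
qed


section \<open>Removing the first letter\<close>

lemma subseq_Cons_iff:
  "subseq (a # as) (x # xs) \<longleftrightarrow> a = x \<and> subseq as xs \<or> subseq (a # as) xs"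
  using subseq_Cons' by auto

lemma subseq_filter_iff: "subseq u (filter P w) \<longleftrightarrow> (\<forall>x\<in>set u. P x) \<and> subseq u w"
proof (intro iffI conjI ballI)
  assume u: "subseq u (filter P w)"
  then show "subseq u w"
    using subseq_filter_left subseq_order.order_trans by blast
  show "P x" if "x \<in> set u" for x
    using u that by (metis in_mono mem_Collect_eq set_filter set_nths_subset subseq_conv_nths)
next
  assume u: "(\<forall>x\<in>set u. P x) \<and> subseq u w"
  then have "subseq (filter P u) (filter P w)"
    by (intro subseq_filter) simp
  then show "subseq u (filter P w)"
    using u by simp
qed

lemma sorted_wrt_iff_subseq: "sorted_wrt R w \<longleftrightarrow> (\<forall>y z. subseq [y, z] w \<longrightarrow> R y z)"
proof (induction w)
  case (Cons x w)
  then show ?case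
    unfolding sorted_wrt.simps subseq_Cons_iff[of _ _ x w] subseq_singleton_left by blast
qed simp

text \<open>The common form of six avoidance conditions: an earlier letter \<open>x\<close>
  constrains the letters that \<open>g\<close> relates to it, and \<open>R\<close> is the order
  forced on them.\<close>

definition tails_sorted :: "(nat \<Rightarrow> nat \<Rightarrow> bool) \<Rightarrow> (nat \<Rightarrow> nat \<Rightarrow> bool) \<Rightarrow> word \<Rightarrow> bool" where
  "tails_sorted g R w \<longleftrightarrow> (\<forall>x y z. subseq [x, y, z] w \<longrightarrow> g x y \<longrightarrow> g x z \<longrightarrow> R y z)"

lemma tails_sorted_Cons:
  "tails_sorted g R (x # w) \<longleftrightarrow> sorted_wrt R (filter (g x) w) \<and> tails_sorted g R w"
  unfolding tails_sorted_def sorted_wrt_iff_subseq subseq_filter_iff subseq_Cons_iff[of _ _ x w]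
  by auto

text \<open>\<open>Z\<close> is the state of the recursion: the letters constrained by a prefix that
  has been removed. A constantly false \<open>Z\<close> gives the avoiders themselves.\<close>

definition tail_words ::
  "(nat \<Rightarrow> nat \<Rightarrow> bool) \<Rightarrow> (nat \<Rightarrow> nat \<Rightarrow> bool) \<Rightarrow> (nat \<Rightarrow> bool) \<Rightarrow> nat multiset \<Rightarrow> word set" where
  "tail_words g R Z S =
     {w \<in> permutations_of_multiset S. tails_sorted g R w \<and> sorted_wrt R (filter Z w)}"

lemma finite_tail_words [simp]: "finite (tail_words g R Z S)"
  by (simp add: tail_words_def)

lemma tail_words_empty: "tail_words g R Z {#} = {[]}"
  by (auto simp: tail_words_def tails_sorted_def)

text \<open>For \<open>g\<close> being \<open><\<close> or \<open>\<le>\<close> these are the upper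
  sets of letters. The two clauses make constraints nested: \<open>g x\<close> lies inside
  \<open>Z\<close> if \<open>x\<close> is in \<open>Z\<close>, and contains \<open>Z\<close>
  otherwise.\<close>

definition final_segment :: "(nat \<Rightarrow> nat \<Rightarrow> bool) \<Rightarrow> (nat \<Rightarrow> bool) \<Rightarrow> bool" where
  "final_segment g Z \<longleftrightarrow>
     (\<forall>x y. \<not> Z x \<longrightarrow> Z y \<longrightarrow> g x y) \<and> (\<forall>x y. Z x \<longrightarrow> g x y \<longrightarrow> Z y)"

lemma sorted_wrt_filter_mono:
  assumes "sorted_wrt R (filter P w)" "\<And>x. Q x \<Longrightarrow> P x"
  shows "sorted_wrt R (filter Q w)"
  using assms unfolding sorted_wrt_iff_subseq subseq_filter_iff by blast

text \<open>Of two nested constraints only the larger is kept. If \<open>x\<close> is in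
  \<open>Z\<close>, its own constraint is implied and \<open>x\<close> must precede the remaining
  letters of \<open>Z\<close> in the order \<open>R\<close>; otherwise the constraint of
  \<open>x\<close> swallows \<open>Z\<close>.\<close>

lemma Cons_tail_words_iff:
  assumes "final_segment g Z"
  shows "x # w \<in> tail_words g R Z S \<longleftrightarrow> x \<in># S \<and>
    (if Z x then (\<forall>y\<in>#S - {#x#}. Z y \<longrightarrow> R x y) \<and> w \<in> tail_words g R Z (S - {#x#})
     else w \<in> tail_words g R (g x) (S - {#x#}))"
proof (cases "x \<in># S \<and> mset w = S - {#x#}")
  case True
  have w: "w \<in> permutations_of_multiset (S - {#x#})" "set w = set_mset (S - {#x#})"
    using True by (auto simp: permutations_of_multiset_def simp flip: set_mset_mset)
  show ?thesis
  proof (cases "Z x")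
    case True
    then have "sorted_wrt R (filter Z w) \<Longrightarrow> sorted_wrt R (filter (g x) w)"
      using assms by (auto simp: final_segment_def elim: sorted_wrt_filter_mono)
    then show ?thesis
      using True w \<open>x \<in># S \<and> _\<close>
      by (auto simp: tail_words_def permutations_of_multiset_Cons_iff tails_sorted_Cons)
  next
    case False
    then have "sorted_wrt R (filter (g x) w) \<Longrightarrow> sorted_wrt R (filter Z w)"
      using assms by (auto simp: final_segment_def elim: sorted_wrt_filter_mono)
    then show ?thesis
      using False w \<open>x \<in># S \<and> _\<close>
      by (auto simp: tail_words_def permutations_of_multiset_Cons_iff tails_sorted_Cons)
  qed
next
  case False
  then show ?thesis
    by (auto simp: tail_words_def permutations_of_multiset_Cons_iff dest: permutations_of_multisetD)
qed

text \<open>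
  The predicate \<open>ok\<close> describes the multisets whose letters can be arranged in increasing
  order with respect to \<open>R\<close>; the arrangement is then unique.
\<close>

locale letter_sorting =
  fixes R :: "nat \<Rightarrow> nat \<Rightarrow> bool" and ok :: "nat multiset \<Rightarrow> bool"
  assumes sorted_ok: "sorted_wrt R w \<Longrightarrow> ok (mset w)"
    and ex1_first: "ok U \<Longrightarrow> U \<noteq> {#} \<Longrightarrow> \<exists>!x. x \<in># U \<and> (\<forall>y\<in>#U - {#x#}. R x y)"
    and ok_diff: "ok U \<Longrightarrow> ok (U - {#x#})"
    and ok_union: "set_mset U \<inter> set_mset V = {} \<Longrightarrow> ok (U + V) \<longleftrightarrow> ok U \<and> ok V"
begin

lemma tail_words_not_ok:
  assumes "\<not> ok (filter_mset Z S)"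
  shows "tail_words g R Z S = {}"
  using assms sorted_ok by (fastforce simp: tail_words_def permutations_of_multiset_def)

text \<open>Among the constrained letters exactly one can come first, while every unconstrained
  letter can. The recursion depends on \<open>R\<close> only through the identity of
  \<open>t\<close>, which is therefore left existential.\<close>

lemma card_tail_words:
  assumes g: "final_segment g Z" and ok: "ok (filter_mset Z S)" and S: "S \<noteq> {#}"
  obtains "filter_mset Z S = {#}"
      "card (tail_words g R Z S) =
         (\<Sum>x\<in>{x \<in> set_mset S. \<not> Z x}. card (tail_words g R (g x) (S - {#x#})))"
    | t where "t \<in># S" "Z t"
      "card (tail_words g R Z S) =
         (\<Sum>x\<in>{x \<in> set_mset S. \<not> Z x}. card (tail_words g R (g x) (S - {#x#})))
         + card (tail_words g R Z (S - {#t#}))"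
proof -
  define B where "B x = {w. x # w \<in> tail_words g R Z S}" for x
  have "tail_words g R Z S \<subseteq> (\<Union>x\<in>set_mset S. (#) x ` B x)"
  proof
    fix w assume w: "w \<in> tail_words g R Z S"
    then have "mset w = S"
      by (simp add: tail_words_def permutations_of_multiset_def)
    with S w show "w \<in> (\<Union>x\<in>set_mset S. (#) x ` B x)"
      by (cases w) (auto simp: B_def)
  qed
  moreover have "(#) x ` B x \<subseteq> tail_words g R Z S" for x
    by (auto simp: B_def)
  ultimately have un: "tail_words g R Z S = (\<Union>x\<in>set_mset S. (#) x ` B x)"
    by blast
  have "finite (B x)" for x
    by (rule finite_imageD[of "(#) x"], rule finite_subset[OF _ finite_tail_words])
      (auto simp: B_def)
  then have "card (tail_words g R Z S) = (\<Sum>x\<in>set_mset S. card (B x))"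
    unfolding un by (subst card_UN_disjoint) (auto simp: card_image)
  also have "set_mset S = {x \<in> set_mset S. \<not> Z x} \<union> {x \<in> set_mset S. Z x}"
    by auto
  also have "(\<Sum>x\<in>\<dots>. card (B x)) =
      (\<Sum>x\<in>{x \<in> set_mset S. \<not> Z x}. card (B x)) + (\<Sum>x\<in>{x \<in> set_mset S. Z x}. card (B x))"
    by (rule sum.union_disjoint) auto
  also have "(\<Sum>x\<in>{x \<in> set_mset S. \<not> Z x}. card (B x)) =
      (\<Sum>x\<in>{x \<in> set_mset S. \<not> Z x}. card (tail_words g R (g x) (S - {#x#})))"
    by (rule sum.cong) (auto simp: B_def Cons_tail_words_iff[OF g])
  finally have card: "card (tail_words g R Z S) =
      (\<Sum>x\<in>{x \<in> set_mset S. \<not> Z x}. card (tail_words g R (g x) (S - {#x#})))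
      + (\<Sum>x\<in>{x \<in> set_mset S. Z x}. card (B x))" .
  show thesis
  proof (cases "filter_mset Z S = {#}")
    case True
    then have "{x \<in> set_mset S. Z x} = {}"
      by (simp flip: set_mset_filter)
    then show ?thesis
      using that(1)[OF True] card by (simp only: sum.empty add_0_right)
  next
    case False
    have first: "(\<forall>y\<in>#filter_mset Z S - {#x#}. R x y) \<longleftrightarrow> (\<forall>y\<in>#S - {#x#}. Z y \<longrightarrow> R x y)"
      if "x \<in># filter_mset Z S" for x
    proof -
      have "filter_mset Z S - {#x#} = filter_mset Z (S - {#x#})"
        using that by simp
      then have "set_mset (filter_mset Z S - {#x#}) = {y \<in> set_mset (S - {#x#}). Z y}"
        by (simp only: set_mset_filter)
      then show ?thesis
        by blast
    qed
    from ex1_first[OF ok False]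
    obtain t where t: "t \<in># filter_mset Z S" "\<forall>y\<in>#filter_mset Z S - {#t#}. R t y"
      and unique: "\<And>x. x \<in># filter_mset Z S \<Longrightarrow> \<forall>y\<in>#filter_mset Z S - {#x#}. R x y \<Longrightarrow> x = t"
      by (elim ex1E conjE) (rule that; assumption?; blast)
    have "(\<Sum>x\<in>{x \<in> set_mset S. Z x}. card (B x)) = (\<Sum>x\<in>{t}. card (B x))"
    proof (rule sum.mono_neutral_right)
      show "\<forall>x\<in>{x \<in> set_mset S. Z x} - {t}. card (B x) = 0"
        using unique first by (auto simp: B_def Cons_tail_words_iff[OF g])
    qed (use t in auto)
    also have "\<dots> = card (tail_words g R Z (S - {#t#}))"
      using t first[OF t(1)] by (simp add: B_def Cons_tail_words_iff[OF g])
    finally show ?thesis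
      using that(2)[of t] t(1) card by simp
  qed
qed

end

text \<open>Inside \<open>Z\<close> the multisets may consist of different letters, since the two
  orders consume different ones. What persists is the equality outside \<open>Z\<close>, the number
  of constrained letters, and whether these can be sorted at all. For strict orders the last item
  does not follow from the others, because repeated letters cannot be sorted strictly.\<close>

lemma card_tail_words_eq:
  assumes "letter_sorting R ok" "letter_sorting R' ok"
    and seg: "\<And>x. final_segment g (g x)" and irr: "final_segment g Z"
    and "filter_mset (\<lambda>x. \<not> Z x) S = filter_mset (\<lambda>x. \<not> Z x) T"
    and "size (filter_mset Z S) = size (filter_mset Z T)"
    and "ok (filter_mset Z S) \<longleftrightarrow> ok (filter_mset Z T)"
  shows "card (tail_words g R Z S) = card (tail_words g R' Z T)"
  using irr assms(5-)
proof (induction "size S" arbitrary: S T Z rule: less_induct)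
  case (less S T Z)
  interpret R: letter_sorting R ok by fact
  interpret R': letter_sorting R' ok by fact
  show ?case
  proof (cases "S = {#} \<or> \<not> ok (filter_mset Z S)")
    case True
    then consider "S = {#}" | "\<not> ok (filter_mset Z S)" by blast
    then show ?thesis
    proof cases
      case 1
      have "T = filter_mset Z T + filter_mset (\<lambda>x. \<not> Z x) T"
        by (rule multiset_partition)
      also have "\<dots> = {#}"
        using 1 less.prems by (metis add_0 filter_empty_mset size_eq_0_iff_empty size_empty)
      finally show ?thesis
        using 1 by (simp add: tail_words_empty)
    next
      case 2
      then show ?thesis
        using less.prems by (simp add: R.tail_words_not_ok R'.tail_words_not_ok)
    qed
  next
    case False
    then have S: "S \<noteq> {#}" "ok (filter_mset Z S)" and T: "ok (filter_mset Z T)"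
      using less.prems by auto
    have size: "size S = size T"
      using less.prems multiset_partition[of S Z] multiset_partition[of T Z] by (metis size_union)
    then have "T \<noteq> {#}"
      using S by auto
    have low: "{x \<in> set_mset S. \<not> Z x} = {x \<in> set_mset T. \<not> Z x}"
      using less.prems(2) by (metis set_mset_filter)
    have "card (tail_words g R (g x) (S - {#x#})) = card (tail_words g R' (g x) (T - {#x#}))"
      if "x \<in># S" "x \<in># T" "\<not> Z x" for x
    proof (rule less.hyps)
      show "size (S - {#x#}) < size S"
        using that by (simp add: size_Diff1_less)
      show "final_segment g (g x)"
        by (rule seg)
      have Zg: "Z y \<Longrightarrow> g x y" for y
        using less.prems(1) that by (auto simp: final_segment_def)
      have eq: "filter_mset (\<lambda>y. \<not> Z y) (S - {#x#}) = filter_mset (\<lambda>y. \<not> Z y) (T - {#x#})"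
        using less.prems(2) that by simp
      have "filter_mset (\<lambda>y. \<not> g x y) U = filter_mset (\<lambda>y. \<not> g x y) (filter_mset (\<lambda>y. \<not> Z y) U)" for U
        unfolding filter_filter_mset by (intro filter_mset_cong) (use Zg in auto)
      then show "filter_mset (\<lambda>y. \<not> g x y) (S - {#x#}) = filter_mset (\<lambda>y. \<not> g x y) (T - {#x#})"
        using eq by metis
      \<comment> \<open>\<open>V\<close> collects the letters newly constrained by \<open>x\<close>.
        They lie outside \<open>Z\<close>, where \<open>S\<close> and \<open>T\<close> agree, so
        both constrained parts grow by the same \<open>V\<close>.\<close>
      define V where "V = filter_mset (g x) (filter_mset (\<lambda>y. \<not> Z y) (S - {#x#}))"
      have split: "filter_mset (g x) (U - {#x#}) = V + filter_mset Z U"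
        if "filter_mset (\<lambda>y. \<not> Z y) (U - {#x#}) = filter_mset (\<lambda>y. \<not> Z y) (S - {#x#})" for U
      proof -
        have "filter_mset (g x) (U - {#x#}) =
            filter_mset Z (filter_mset (g x) (U - {#x#})) + filter_mset (\<lambda>y. \<not> Z y) (filter_mset (g x) (U - {#x#}))"
          by (rule multiset_partition)
        also have "filter_mset (\<lambda>y. \<not> Z y) (filter_mset (g x) (U - {#x#})) = V"
          unfolding V_def that[symmetric] filter_filter_mset by (intro filter_mset_cong) auto
        also have "filter_mset Z (filter_mset (g x) (U - {#x#})) = filter_mset Z (U - {#x#})"
          unfolding filter_filter_mset by (intro filter_mset_cong) (use Zg in auto)
        also have "\<dots> = filter_mset Z U"
          using \<open>\<not> Z x\<close> by (simp add: filter_diff_mset)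
        finally show ?thesis by (simp add: add.commute)
      qed
      show "size (filter_mset (g x) (S - {#x#})) = size (filter_mset (g x) (T - {#x#}))"
        using less.prems(3) by (simp only: split[OF refl] split[OF eq[symmetric]] size_union)
      have "set_mset V \<inter> set_mset (filter_mset Z U) = {}" for U
        by (auto simp: V_def dest: in_diffD)
      then show "ok (filter_mset (g x) (S - {#x#})) \<longleftrightarrow> ok (filter_mset (g x) (T - {#x#}))"
        using less.prems(4) by (simp only: split[OF refl] split[OF eq[symmetric]] R.ok_union)
    qed
    then have sum: "(\<Sum>x\<in>{x \<in> set_mset S. \<not> Z x}. card (tail_words g R (g x) (S - {#x#}))) =
        (\<Sum>x\<in>{x \<in> set_mset T. \<not> Z x}. card (tail_words g R' (g x) (T - {#x#})))"
      using low by (intro sum.cong) auto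
    \<comment> \<open>Here \<open>S\<close> and \<open>T\<close> drift apart: \<open>s\<close> and
      \<open>t\<close> are different letters in general, but both lie in \<open>Z\<close>, so the
      invariants survive.\<close>
    have top: "card (tail_words g R Z (S - {#s#})) = card (tail_words g R' Z (T - {#t#}))"
      if "s \<in># S" "Z s" "t \<in># T" "Z t" for s t
    proof (rule less.hyps)
      show "size (S - {#s#}) < size S"
        using that by (simp add: size_Diff1_less)
      show "ok (filter_mset Z (S - {#s#})) \<longleftrightarrow> ok (filter_mset Z (T - {#t#}))"
        using that S T R.ok_diff by simp
    qed (use less.prems that in \<open>simp_all add: filter_diff_mset size_Diff_singleton\<close>)
    have Z_empty: "filter_mset Z S = {#} \<longleftrightarrow> filter_mset Z T = {#}"
      using less.prems(3) by (metis size_eq_0_iff_empty)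
    show ?thesis
    proof (rule R.card_tail_words[OF less.prems(1) S(2,1)], goal_cases)
      case S: 1
      show ?case
      proof (rule R'.card_tail_words[OF less.prems(1) T \<open>T \<noteq> {#}\<close>], goal_cases)
        case 1
        then show ?case
          using S(2) sum by (simp only:)
      next
        case (2 t)
        then show ?case
          using S(1) Z_empty by simp
      qed
    next
      case S: (2 s)
      show ?case
      proof (rule R'.card_tail_words[OF less.prems(1) T \<open>T \<noteq> {#}\<close>], goal_cases)
        case 1
        then show ?case
          using S(1,2) Z_empty by simp
      next
        case (2 t)
        then show ?case
          using S(3) sum top[OF S(1,2) 2(1,2)] by (simp only:)
      qed
    qed
  qed
qed

text \<open>Two different candidates for the first place would have to precede each other.\<close>

lemma ex1_first_element:
  assumes "t \<in># U \<and> (\<forall>y\<in>#U - {#t#}. R t y)"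
    and "\<And>x y. R x y \<Longrightarrow> R y x \<Longrightarrow> x = y"
  shows "\<exists>!x. x \<in># U \<and> (\<forall>y\<in>#U - {#x#}. R x y)"
proof (rule ex1I)
  show "t \<in># U \<and> (\<forall>y\<in>#U - {#t#}. R t y)"
    by fact
  fix x assume x: "x \<in># U \<and> (\<forall>y\<in>#U - {#x#}. R x y)"
  show "x = t"
  proof (rule ccontr)
    assume "x \<noteq> t"
    then have "R t x" "R x t"
      using assms(1) x by (simp_all add: in_diff_count)
    then show False
      using assms(2) \<open>x \<noteq> t\<close> by blast
  qed
qed

section \<open>The four orders on letters\<close>

interpretation sorting_le: letter_sorting "(\<le>)" "\<lambda>_. True"
proof
  fix U :: "nat multiset" assume "U \<noteq> {#}"
  then have "Min (set_mset U) \<in># U \<and> (\<forall>y\<in>#U - {#Min (set_mset U)#}. Min (set_mset U) \<le> y)"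
    by (auto dest: in_diffD)
  then show "\<exists>!x. x \<in># U \<and> (\<forall>y\<in>#U - {#x#}. x \<le> y)"
    by (rule ex1_first_element) auto
qed simp_all

interpretation sorting_ge: letter_sorting "(\<ge>)" "\<lambda>_. True"
proof
  fix U :: "nat multiset" assume "U \<noteq> {#}"
  then have "Max (set_mset U) \<in># U \<and> (\<forall>y\<in>#U - {#Max (set_mset U)#}. Max (set_mset U) \<ge> y)"
    by (auto dest: in_diffD)
  then show "\<exists>!x. x \<in># U \<and> (\<forall>y\<in>#U - {#x#}. x \<ge> y)"
    by (rule ex1_first_element) auto
qed simp_all

text \<open>The \<open>ok\<close> of the two strict orders; for the weak ones every multiset can be
  sorted.\<close>

definition multiplicity_free :: "nat multiset \<Rightarrow> bool" where
  "multiplicity_free U \<longleftrightarrow> (\<forall>x. count U x \<le> 1)"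

lemma multiplicity_free_mset_iff: "multiplicity_free (mset w) \<longleftrightarrow> distinct w"
  unfolding multiplicity_free_def
  by (induction w) (auto simp: count_mset_0_iff le_Suc_eq split: if_splits)

lemma multiplicity_free_diff: "multiplicity_free U \<Longrightarrow> multiplicity_free (U - {#x#})"
  unfolding multiplicity_free_def by (auto intro: le_trans[OF diff_le_self])

lemma multiplicity_free_union:
  assumes "set_mset U \<inter> set_mset V = {}"
  shows "multiplicity_free (U + V) \<longleftrightarrow> multiplicity_free U \<and> multiplicity_free V"
proof -
  have "count (U + V) x \<le> 1 \<longleftrightarrow> count U x \<le> 1 \<and> count V x \<le> 1" for x
    using assms by (cases "x \<in># U") (auto simp: disjoint_iff not_in_iff)
  then show ?thesis
    unfolding multiplicity_free_def by blast
qed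

lemma multiplicity_free_diff_not_in:
  "multiplicity_free U \<Longrightarrow> x \<notin># U - {#x#}"
  unfolding multiplicity_free_def by (simp add: not_in_iff)

interpretation sorting_less: letter_sorting "(<)" multiplicity_free
proof
  fix U :: "nat multiset" assume U: "U \<noteq> {#}" "multiplicity_free U"
  have "Min (set_mset U) < y" if "y \<in># U - {#Min (set_mset U)#}" for y
  proof -
    have "Min (set_mset U) \<le> y"
      using that by (auto dest: in_diffD)
    moreover have "Min (set_mset U) \<noteq> y"
      using that multiplicity_free_diff_not_in[OF U(2)] by auto
    ultimately show ?thesis by simp
  qed
  then have "Min (set_mset U) \<in># U \<and> (\<forall>y\<in>#U - {#Min (set_mset U)#}. Min (set_mset U) < y)"
    using U by auto
  then show "\<exists>!x. x \<in># U \<and> (\<forall>y\<in>#U - {#x#}. x < y)"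
    by (rule ex1_first_element) auto
next
  show "multiplicity_free (mset w)" if "sorted_wrt (<) w" for w
    using that by (simp add: multiplicity_free_mset_iff strict_sorted_iff)
qed (simp_all add: multiplicity_free_diff multiplicity_free_union)

interpretation sorting_greater: letter_sorting "(>)" multiplicity_free
proof
  fix U :: "nat multiset" assume U: "U \<noteq> {#}" "multiplicity_free U"
  have "Max (set_mset U) > y" if "y \<in># U - {#Max (set_mset U)#}" for y
  proof -
    have "Max (set_mset U) \<ge> y"
      using that by (auto dest: in_diffD)
    moreover have "Max (set_mset U) \<noteq> y"
      using that multiplicity_free_diff_not_in[OF U(2)] by auto
    ultimately show ?thesis by simp
  qed
  then have "Max (set_mset U) \<in># U \<and> (\<forall>y\<in>#U - {#Max (set_mset U)#}. Max (set_mset U) > y)"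
    using U by auto
  then show "\<exists>!x. x \<in># U \<and> (\<forall>y\<in>#U - {#x#}. x > y)"
    by (rule ex1_first_element) auto
next
  show "multiplicity_free (mset w)" if "sorted_wrt (>) w" for w
    using that strict_sorted_iff[of "rev w"] by (simp add: multiplicity_free_mset_iff sorted_wrt_rev)
qed (simp_all add: multiplicity_free_diff multiplicity_free_union)

lemma av_eq_if_tails_sorted:
  assumes "letter_sorting R ok" "letter_sorting R' ok"
    and "\<And>x. final_segment g (g x)"
    and P: "\<And>w. (\<forall>\<rho>\<in>P. avoids w \<rho>) \<longleftrightarrow> tails_sorted g R w"
    and Q: "\<And>w. (\<forall>\<rho>\<in>Q. avoids w \<rho>) \<longleftrightarrow> tails_sorted g R' w"
  shows "av S P = av S Q"
proof -
  have "card (tail_words g R (\<lambda>_. False) S) = card (tail_words g R' (\<lambda>_. False) S)"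
    using assms(1-3) by (rule card_tail_words_eq) (simp_all add: final_segment_def)
  then show ?thesis
    by (simp add: av_def P Q tail_words_def)
qed

lemma final_segment_less: "final_segment (<) ((<) x)"
  and final_segment_le: "final_segment (\<le>) ((\<le>) x)"
  by (auto simp: final_segment_def)

lemma avoids_iff_tails_sorted:
  assumes "\<And>u. (\<exists>\<rho>\<in>P. same_order u \<rho>) \<longleftrightarrow> (\<exists>x y z. u = [x, y, z] \<and> g x y \<and> g x z \<and> \<not> R y z)"
  shows "(\<forall>\<rho>\<in>P. avoids w \<rho>) \<longleftrightarrow> tails_sorted g R w"
proof -
  have "(\<forall>\<rho>\<in>P. avoids w \<rho>) \<longleftrightarrow> \<not> (\<exists>u. subseq u w \<and> (\<exists>\<rho>\<in>P. same_order u \<rho>))"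
    unfolding contains_pattern_iff_subseq by blast
  then show ?thesis
    unfolding assms tails_sorted_def by blast
qed

lemma av_123_132: "av S {[1,2,3]} = av S {[1,3,2]}"
proof (rule av_eq_if_tails_sorted)
  show "(\<forall>\<rho>\<in>{[1,2,3]}. avoids w \<rho>) \<longleftrightarrow> tails_sorted (<) (\<ge>) w" for w
    by (rule avoids_iff_tails_sorted) (auto simp: same_order_length3)
  show "(\<forall>\<rho>\<in>{[1,3,2]}. avoids w \<rho>) \<longleftrightarrow> tails_sorted (<) (\<le>) w" for w
    by (rule avoids_iff_tails_sorted) (auto simp: same_order_length3)
qed (rule sorting_ge.letter_sorting_axioms sorting_le.letter_sorting_axioms final_segment_less)+

text \<open>A violation of weak decrease is x \<le> y < z, which is 112 or 123; a violation of weak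
  increase is x \<le> z < y, which is 121 or 132.\<close>

lemma av_112_123_121_132: "av S {[1,1,2], [1,2,3]} = av S {[1,2,1], [1,3,2]}"
proof (rule av_eq_if_tails_sorted)
  show "(\<forall>\<rho>\<in>{[1,1,2], [1,2,3]}. avoids w \<rho>) \<longleftrightarrow> tails_sorted (\<le>) (\<ge>) w" for w
    by (rule avoids_iff_tails_sorted) (auto simp: same_order_length3)
  show "(\<forall>\<rho>\<in>{[1,2,1], [1,3,2]}. avoids w \<rho>) \<longleftrightarrow> tails_sorted (\<le>) (\<le>) w" for w
    by (rule avoids_iff_tails_sorted) (auto simp: same_order_length3)
qed (rule sorting_ge.letter_sorting_axioms sorting_le.letter_sorting_axioms final_segment_le)+

text \<open>Strictness turns ties into violations: x < y \<le> z is 122 or 123, and x < z \<le> y is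
  122 or 132.\<close>

lemma av_122_123_122_132: "av S {[1,2,2], [1,2,3]} = av S {[1,2,2], [1,3,2]}"
proof (rule av_eq_if_tails_sorted)
  show "(\<forall>\<rho>\<in>{[1,2,2], [1,2,3]}. avoids w \<rho>) \<longleftrightarrow> tails_sorted (<) (>) w" for w
    by (rule avoids_iff_tails_sorted) (auto simp: same_order_length3)
  show "(\<forall>\<rho>\<in>{[1,2,2], [1,3,2]}. avoids w \<rho>) \<longleftrightarrow> tails_sorted (<) (<) w" for w
    by (rule avoids_iff_tails_sorted) (auto simp: same_order_length3)
qed (rule sorting_greater.letter_sorting_axioms sorting_less.letter_sorting_axioms final_segment_less)+

section \<open>The thirteen patterns and the effect of 111\<close>

definition pattern_list :: "word list" where
  "pattern_list = [[1,1,1], [1,1,2], [1,2,1], [2,1,1], [1,2,2], [2,1,2], [2,2,1],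
     [1,2,3], [1,3,2], [2,1,3], [2,3,1], [3,1,2], [3,2,1]]"

lemma patterns3_eq: "patterns3 = set pattern_list"
proof -
  have iff: "w \<in> patterns3 \<longleftrightarrow> length w = 3 \<and> (\<exists>k\<ge>1. set w = {1..k})" for w
    by (auto simp: patterns3_def reduced_def permutations_of_multiset_def)
  have "w \<in> patterns3 \<longleftrightarrow>
      w \<in> set (filter (\<lambda>w. \<exists>k\<in>set [1,2,3]. set w = set [1..<Suc k]) (List.n_lists 3 [1,2,3]))"
    (is "_ \<longleftrightarrow> w \<in> set ?ws") for w
  proof
    assume "w \<in> patterns3"
    then obtain k where k: "length w = 3" "k \<ge> 1" "set w = {1..k}"
      using iff by blast
    then have "k \<le> 3"
      using card_length[of w] by simp
    then have "k \<in> set [1,2,3]"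
      using k(2) by auto
    moreover have "set w = set [1..<Suc k]"
      using k(3) by (simp add: atLeastLessThanSuc_atLeastAtMost del: upt_Suc)
    moreover have "w \<in> set (List.n_lists 3 [1,2,3])"
      using k \<open>k \<in> set [1,2,3]\<close> by (auto simp: set_n_lists)
    ultimately show "w \<in> set ?ws"
      by auto
  next
    assume "w \<in> set ?ws"
    then show "w \<in> patterns3"
      unfolding iff by (auto simp: set_n_lists atLeastLessThanSuc_atLeastAtMost simp del: upt_Suc)
  qed
  then have "patterns3 = set ?ws"
    by blast
  also have "?ws = [[1,1,1], [2,1,1], [1,2,1], [2,2,1], [3,2,1], [2,3,1], [1,1,2], [2,1,2], [3,1,2],
      [1,2,2], [1,3,2], [2,1,3], [1,2,3]]"
    by code_simp
  also have "set \<dots> = set pattern_list"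
    by (auto simp: pattern_list_def)
  finally show ?thesis .
qed

lemma subseq_replicate_iff: "subseq (replicate n x) w \<longleftrightarrow> n \<le> count (mset w) x"
proof (induction w arbitrary: n)
  case Nil
  then show ?case by (cases n) auto
next
  case (Cons y w)
  show ?case
  proof (cases n)
    case (Suc m)
    then have "subseq (replicate n x) (y # w) \<longleftrightarrow>
        x = y \<and> subseq (replicate m x) w \<or> subseq (replicate (Suc m) x) w"
      by (simp only: replicate_Suc subseq_Cons_iff[of x _ y w])
    also have "\<dots> \<longleftrightarrow> n \<le> count (mset (y # w)) x"
      unfolding Cons.IH using Suc by auto
    finally show ?thesis .
  qed simp
qed

lemma contains_111_iff: "contains_pattern w [1,1,1] \<longleftrightarrow> (\<exists>x. count (mset w) x \<ge> 3)"
proof -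
  have "subseq [x, x, x] w \<longleftrightarrow> count (mset w) x \<ge> 3" for x
    using subseq_replicate_iff[of 3 x w] by (simp add: numeral_3_eq_3)
  moreover have "same_order u [1,1,1] \<longleftrightarrow> (\<exists>x. u = [x, x, x])" for u
  proof
    assume "same_order u [1,1,1]"
    then obtain x y z where "u = [x, y, z]" "x = y" "y = z"
      unfolding same_order_length3 by (metis linorder_neqE_nat less_irrefl)
    then show "\<exists>x. u = [x, x, x]" by simp
  qed (auto simp: same_order_length3)
  ultimately show ?thesis
    unfolding contains_pattern_iff_subseq by auto
qed

lemma av_insert_111:
  "av S (insert [1,1,1] P) = (if \<exists>x. count S x \<ge> 3 then 0 else av S P)"
proof -
  have "{w \<in> permutations_of_multiset S. \<forall>\<rho>\<in>insert [1,1,1] P. avoids w \<rho>} =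
      (if \<exists>x. count S x \<ge> 3 then {} else {w \<in> permutations_of_multiset S. \<forall>\<rho>\<in>P. avoids w \<rho>})"
    unfolding contains_111_iff ball_simps by (auto dest: permutations_of_multisetD)
  then show ?thesis
    unfolding av_def by auto
qed

lemma m_equivalent_insert_111:
  assumes "P \<sim>\<^sub>m Q"
  shows "insert [1,1,1] P \<sim>\<^sub>m insert [1,1,1] Q"
  using assms unfolding m_equivalent_def av_insert_111 by simp

section \<open>Equivalences obtained from the symmetries\<close>

lemma m_equivalent_refl [simp]: "P \<sim>\<^sub>m P"
  and m_equivalent_sym: "P \<sim>\<^sub>m Q \<Longrightarrow> Q \<sim>\<^sub>m P"
  and m_equivalent_trans [trans]: "P \<sim>\<^sub>m Q \<Longrightarrow> Q \<sim>\<^sub>m R \<Longrightarrow> P \<sim>\<^sub>m R"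
  by (auto simp: m_equivalent_def)

lemma m_equivalent_rev: "P \<sim>\<^sub>m rev ` P"
  by (simp add: m_equivalent_def av_rev)

lemma m_equivalent_complement:
  assumes "P \<sim>\<^sub>m Q" "P \<subseteq> patterns3" "Q \<subseteq> patterns3"
  shows "complement ` P \<sim>\<^sub>m complement ` Q"
  unfolding m_equivalent_def
proof (intro allI impI)
  fix S assume S: "reduced S"
  have "av S (complement ` X) = av (complement_multiset S) X" if "X \<subseteq> patterns3" for X
    using av_complement[OF reduced_complement_multiset[OF S] that]
    by (simp add: complement_multiset_involution[OF S])
  then show "av S (complement ` P) = av S (complement ` Q)"
    using assms reduced_complement_multiset[OF S] by (simp add: m_equivalent_def)
qed

lemma m_equivalent_rev_complement:
  assumes "P \<sim>\<^sub>m Q" "P \<subseteq> patterns3" "Q \<subseteq> patterns3"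
  shows "rev ` complement ` P \<sim>\<^sub>m rev ` complement ` Q"
  using m_equivalent_complement[OF assms] unfolding m_equivalent_def av_rev .

lemma m_equivalent_123_132: "{[1,2,3]} \<sim>\<^sub>m {[1,3,2]}"
  unfolding m_equivalent_def av_123_132 by simp

lemma m_equivalent_123_213: "{[1,2,3]} \<sim>\<^sub>m {[2,1,3]}"
  using m_equivalent_rev_complement[OF m_equivalent_123_132]
  by (simp add: patterns3_eq pattern_list_def complement_def)

text \<open>The first-letter recursion proves the mirror image, with 122 in place of 112. Reverse
  complement sends 122 to 112 and 132 to 213, and fixes 123.\<close>

lemma m_equivalent_112_123_112_213: "{[1,1,2], [1,2,3]} \<sim>\<^sub>m {[1,1,2], [2,1,3]}"
proof -
  have "{[1,2,2], [1,2,3]} \<sim>\<^sub>m {[1,2,2], [1,3,2]}"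
    unfolding m_equivalent_def av_122_123_122_132 by simp
  then have "rev ` complement ` {[1,2,2], [1,2,3]} \<sim>\<^sub>m rev ` complement ` {[1,2,2], [1,3,2]}"
    by (rule m_equivalent_rev_complement) (simp_all add: patterns3_eq pattern_list_def)
  then show ?thesis
    by (simp add: complement_def numeral_eq_Suc)
qed

section \<open>Inserting the smallest letter\<close>

lemma distinct_iff_subseq: "distinct v \<longleftrightarrow> (\<forall>z. \<not> subseq [z, z] v)"
proof (induction v)
  case (Cons x v)
  then show ?case
    unfolding subseq_Cons_iff[of _ _ x v] subseq_singleton_left by auto
qed simp

lemma subseq_set_subset: "subseq us vs \<Longrightarrow> set us \<subseteq> set vs"
  using set_nths_subset by (metis subseq_conv_nths)

text \<open>One shape for both ways of inserting all copies of \<open>i\<close>: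
  \<open>c = 0\<close> gives the adjacent block that 121 requires, and \<open>b = 1\<close> leaves
  the first copy in place and sends the others to the end, as 112 requires.\<close>

definition surround :: "nat \<Rightarrow> nat \<Rightarrow> nat \<Rightarrow> word \<Rightarrow> word \<Rightarrow> word" where
  "surround i b c u v = u @ replicate b i @ v @ replicate c i"

lemma mset_surround: "mset (surround i b c u v) = mset (u @ v) + replicate_mset (b + c) i"
  by (rule multiset_eqI) (simp add: surround_def)

lemma filter_surround:
  assumes "i \<notin> set (u @ v)"
  shows "filter (\<lambda>x. x \<noteq> i) (surround i b c u v) = u @ v"
proof -
  have "filter (\<lambda>x. x \<noteq> i) w = w" if "i \<notin> set w" for w
    using that by (induction w) auto
  then show ?thesis
    using assms by (simp add: surround_def)
qed

lemma takeWhile_surround: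
  assumes "i \<notin> set u" "b \<ge> 1"
  shows "takeWhile (\<lambda>x. x \<noteq> i) (surround i b c u v) = u"
proof -
  have "takeWhile (\<lambda>x. x \<noteq> i) (u @ replicate b i @ v @ replicate c i) =
      u @ takeWhile (\<lambda>x. x \<noteq> i) (replicate b i @ v @ replicate c i)"
    using assms by (intro takeWhile_append2) auto
  then show ?thesis
    using assms(2) by (cases b) (simp_all add: surround_def)
qed

lemma subseq_surround_iff:
  assumes "i \<notin> set (u @ v)" "i \<notin> set xs"
  shows "subseq xs (surround i b c u v) \<longleftrightarrow> subseq xs (u @ v)"
  using subseq_filter_iff[of xs "\<lambda>x. x \<noteq> i" "surround i b c u v"] assms
  by (auto simp: filter_surround)

text \<open>The leading letter may be matched with the first copy of \<open>i\<close>. As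
  \<open>xs\<close> has no \<open>i\<close>, the rest must be found in \<open>v\<close>.\<close>

lemma subseq_first_surround_iff:
  assumes "i \<notin> set (u @ v)" "b \<ge> 1" "i \<notin> set xs"
  shows "subseq (i # xs) (surround i b c u v) \<longleftrightarrow> subseq xs v"
proof -
  obtain d where b: "b = Suc d"
    using assms(2) by (cases b) auto
  have drop: "subseq (i # xs) (w @ i # w') \<longleftrightarrow> subseq xs w'" if "i \<notin> set w" for w w'
    using that by (induction w) auto
  have "subseq (i # xs) (surround i b c u v) \<longleftrightarrow> subseq xs (surround i d c [] v)"
    using assms(1) drop[of u "replicate d i @ v @ replicate c i"] by (simp add: surround_def b)
  also have "\<dots> \<longleftrightarrow> subseq xs v"
    using assms subseq_surround_iff[of i "[]" v xs d c] by simp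
  finally show ?thesis .
qed

text \<open>The copies at the end have no other letter behind them, so the middle letter is taken
  from the block between \<open>u\<close> and \<open>v\<close>.\<close>

lemma subseq_middle_surround_iff:
  assumes "i \<notin> set (u @ v)" "b \<ge> 1" "y \<noteq> i" "z \<noteq> i"
  shows "subseq [y, i, z] (surround i b c u v) \<longleftrightarrow> y \<in> set u \<and> z \<in> set v"
proof -
  have "subseq [y, i, z] (surround i b c w v) \<longleftrightarrow> y \<in> set w \<and> z \<in> set v" if "i \<notin> set w" for w
    using that
  proof (induction w)
    case Nil
    have "\<not> subseq [y, i, z] (surround i b c [] v)"
    proof
      assume "subseq [y, i, z] (surround i b c [] v)"
      then have "subseq [y, i] (replicate b i @ v @ replicate c i)"
        and "subseq [y, i, z] (replicate b i @ v @ replicate c i)"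
        by (auto simp: surround_def intro: subseq_order.order_trans[of _ "[y, i, z]"])
      then have "subseq [y, i, z] (v @ replicate c i)"
        using assms(3) by (induction b) auto
      then have "subseq [i, z] (v @ replicate c i)"
        by (rule subseq_Cons')
      then have "subseq [i, z] (replicate c i)"
        using assms(1) by (induction v) auto
      then show False
        using subseq_set_subset[of "[i, z]" "replicate c i"] assms(4) by (auto split: if_splits)
    qed
    then show ?case by simp
  next
    case (Cons x w)
    have "subseq [i, z] (surround i b c w v) \<longleftrightarrow> z \<in> set v"
      using subseq_first_surround_iff[of i w v b "[z]" c] assms Cons.prems
      by (simp add: subseq_singleton_left)
    moreover have "surround i b c (x # w) v = x # surround i b c w v"
      by (simp add: surround_def)
    ultimately show ?case
      using Cons by (auto simp: subseq_Cons_iff[of _ _ x])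
  qed
  then show ?thesis
    using assms(1) by simp
qed

lemma not_subseq_surround_between:
  assumes "i \<notin> set (u @ v)" "z \<noteq> i"
  shows "\<not> subseq [i, z, i] (surround i b 0 u v)"
proof
  assume "subseq [i, z, i] (surround i b 0 u v)"
  then have "subseq [i, z, i] (replicate b i @ v)"
    using assms(1) by (induction u) (auto simp: surround_def)
  then have "subseq [z, i] (replicate b i @ v)"
    by (rule subseq_Cons')
  then have "subseq [z, i] v"
    using assms(2) by (induction b) auto
  then show False
    using subseq_set_subset[of "[z, i]" v] assms(1) by auto
qed

lemma not_subseq_surround_after:
  assumes "i \<notin> set (u @ v)" "z \<noteq> i"
  shows "\<not> subseq [i, i, z] (surround i 1 c u v)"
proof
  assume "subseq [i, i, z] (surround i 1 c u v)"
  then have "subseq [i, z] (v @ replicate c i)"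
    using assms(1) by (induction u) (auto simp: surround_def)
  then have "subseq [i, z] (replicate c i)"
    using assms(1) by (induction v) auto
  then show False
    using subseq_set_subset[of "[i, z]" "replicate c i"] assms(2) by (auto split: if_splits)
qed

context
  fixes u v :: word and i b c :: nat
  assumes less: "\<forall>x\<in>set (u @ v). i < x" and b: "b \<ge> 1"
begin

lemma not_in_surrounded: "i \<notin> set (u @ v)"
  using less by auto

text \<open>An occurrence that uses \<open>i\<close> uses it as its smallest letter. Each lemma
  below only has to match \<open>i\<close> with the letter 1 of its pattern and read off a condition
  on the split.\<close>

lemma contains_pattern_surround:
  "contains_pattern (surround i b c u v) \<rho> \<longleftrightarrow> contains_pattern (u @ v) \<rho> \<or>
     (\<exists>w. subseq w (surround i b c u v) \<and> same_order w \<rho> \<and> i \<in> set w \<and> (\<forall>x\<in>set w. i \<le> x))"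
proof -
  have "\<forall>x\<in>set (surround i b c u v). i \<le> x"
    using less by (auto simp: surround_def le_less)
  then have "\<forall>x\<in>set w. i \<le> x" if "subseq w (surround i b c u v)" for w
    using subseq_set_subset[OF that] by blast
  moreover have "i \<notin> set w" if "subseq w (u @ v)" for w
    using subseq_set_subset[OF that] not_in_surrounded by blast
  ultimately show ?thesis
    unfolding contains_pattern_iff_subseq using subseq_surround_iff[OF not_in_surrounded] by metis
qed

lemma avoids_121_surround:
  assumes "c = 0"
  shows "avoids (surround i b c u v) [1,2,1] \<longleftrightarrow> avoids (u @ v) [1,2,1]"
proof -
  have "same_order w [1,2,1] \<and> i \<in> set w \<and> (\<forall>x\<in>set w. i \<le> x) \<longleftrightarrow> (\<exists>z>i. w = [i, z, i])" for w
    by (auto simp: same_order_length3)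
  then show ?thesis
    unfolding contains_pattern_surround
    using not_subseq_surround_between[OF not_in_surrounded] assms by auto
qed

lemma avoids_112_surround:
  assumes "b = 1"
  shows "avoids (surround i b c u v) [1,1,2] \<longleftrightarrow> avoids (u @ v) [1,1,2]"
proof -
  have "same_order w [1,1,2] \<and> i \<in> set w \<and> (\<forall>x\<in>set w. i \<le> x) \<longleftrightarrow> (\<exists>z>i. w = [i, i, z])" for w
    by (auto simp: same_order_length3)
  then show ?thesis
    unfolding contains_pattern_surround
    using not_subseq_surround_after[OF not_in_surrounded] assms by auto
qed

lemma avoids_212_surround:
  "avoids (surround i b c u v) [2,1,2] \<longleftrightarrow> avoids (u @ v) [2,1,2] \<and> set u \<inter> set v = {}"
proof -
  have *: "same_order w [2,1,2] \<and> i \<in> set w \<and> (\<forall>x\<in>set w. i \<le> x) \<longleftrightarrow> (\<exists>z>i. w = [z, i, z])" for w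
    by (auto simp: same_order_length3)
  have "subseq [z, i, z] (surround i b c u v) \<longleftrightarrow> z \<in> set u \<inter> set v" if "i < z" for z
    using subseq_middle_surround_iff[OF not_in_surrounded b] that by simp
  then have "(\<exists>w. subseq w (surround i b c u v) \<and> (\<exists>z>i. w = [z, i, z])) \<longleftrightarrow> set u \<inter> set v \<noteq> {}"
    using less by auto
  then show ?thesis
    unfolding contains_pattern_surround * by simp
qed

lemma avoids_122_surround:
  "avoids (surround i b c u v) [1,2,2] \<longleftrightarrow> avoids (u @ v) [1,2,2] \<and> distinct v"
proof -
  have *: "same_order w [1,2,2] \<and> i \<in> set w \<and> (\<forall>x\<in>set w. i \<le> x) \<longleftrightarrow> (\<exists>z>i. w = [i, z, z])" for w
    by (auto simp: same_order_length3)
  have "subseq [i, z, z] (surround i b c u v) \<longleftrightarrow> subseq [z, z] v" if "i < z" for z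
    using subseq_first_surround_iff[OF not_in_surrounded b] that by simp
  moreover have "i < z" if "subseq [z, z] v" for z
    using less subseq_set_subset[OF that] by simp
  ultimately have "(\<exists>w. subseq w (surround i b c u v) \<and> (\<exists>z>i. w = [i, z, z])) \<longleftrightarrow> \<not> distinct v"
    unfolding distinct_iff_subseq by metis
  then show ?thesis
    unfolding contains_pattern_surround * by simp
qed

lemma avoids_123_surround:
  "avoids (surround i b c u v) [1,2,3] \<longleftrightarrow> avoids (u @ v) [1,2,3] \<and> sorted_wrt (\<ge>) v"
proof -
  have *: "same_order w [1,2,3] \<and> i \<in> set w \<and> (\<forall>x\<in>set w. i \<le> x) \<longleftrightarrow>
      (\<exists>y z. i < y \<and> y < z \<and> w = [i, y, z])" for w
    by (auto simp: same_order_length3)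
  have "subseq [i, y, z] (surround i b c u v) \<longleftrightarrow> subseq [y, z] v" if "i < y" "y < z" for y z
    using subseq_first_surround_iff[OF not_in_surrounded b] that by simp
  moreover have "i < y" if "subseq [y, z] v" for y z
    using less subseq_set_subset[OF that] by simp
  ultimately have "(\<exists>w. subseq w (surround i b c u v) \<and> (\<exists>y z. i < y \<and> y < z \<and> w = [i, y, z])) \<longleftrightarrow>
      \<not> sorted_wrt (\<ge>) v"
    unfolding sorted_wrt_iff_subseq not_less[symmetric] by metis
  then show ?thesis
    unfolding contains_pattern_surround * by simp
qed

lemma avoids_213_surround:
  "avoids (surround i b c u v) [2,1,3] \<longleftrightarrow> avoids (u @ v) [2,1,3] \<and> (\<forall>y\<in>set u. \<forall>z\<in>set v. z \<le> y)"
proof -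
  have *: "same_order w [2,1,3] \<and> i \<in> set w \<and> (\<forall>x\<in>set w. i \<le> x) \<longleftrightarrow>
      (\<exists>y z. i < y \<and> y < z \<and> w = [y, i, z])" for w
    by (auto simp: same_order_length3)
  have "subseq [y, i, z] (surround i b c u v) \<longleftrightarrow> y \<in> set u \<and> z \<in> set v" if "i < y" "y < z" for y z
    using subseq_middle_surround_iff[OF not_in_surrounded b] that by simp
  moreover have "i < y" if "y \<in> set u" for y
    using less that by simp
  ultimately have "(\<exists>w. subseq w (surround i b c u v) \<and> (\<exists>y z. i < y \<and> y < z \<and> w = [y, i, z])) \<longleftrightarrow>
      \<not> (\<forall>y\<in>set u. \<forall>z\<in>set v. z \<le> y)"
    unfolding not_less[symmetric] by metis
  then show ?thesis
    unfolding contains_pattern_surround * by simp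
qed

end

section \<open>Generating trees labelled by the number of allowed positions\<close>

definition split_points :: "(word \<Rightarrow> word \<Rightarrow> bool) \<Rightarrow> word \<Rightarrow> nat set" where
  "split_points ok w = {p. p \<le> length w \<and> ok (take p w) (drop p w)}"

lemma finite_split_points [simp]: "finite (split_points ok w)"
  by (simp add: split_points_def)

definition good_words :: "(word \<Rightarrow> bool) \<Rightarrow> nat multiset \<Rightarrow> word set" where
  "good_words good S = {w \<in> permutations_of_multiset S. good w}"

lemma finite_good_words [simp]: "finite (good_words good S)"
  by (simp add: good_words_def)

text \<open>
  A good word arises from a good word in larger letters by surrounding one of its suffixes by
  copies of a new smallest letter. The number \<open>child a n r\<close> of allowed positions in the new word
  depends only on the number \<open>a\<close> of copies, the number \<open>n\<close> of allowed positions in the old word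
  and the rank \<open>r\<close> of the chosen position, for a suitable enumeration of these positions.
\<close>

locale smallest_letter_insertion =
  fixes good :: "word \<Rightarrow> bool" and nb :: "nat \<Rightarrow> nat" and na :: "nat \<Rightarrow> nat"
    and ok :: "word \<Rightarrow> word \<Rightarrow> bool" and child :: "nat \<Rightarrow> nat \<Rightarrow> nat \<Rightarrow> nat"
  assumes good_Nil: "good []" and ok_Nil: "ok [] []"
    and counts: "a \<ge> 1 \<Longrightarrow> nb a \<ge> 1 \<and> nb a + na a = a"
    and good_surround: "\<forall>x\<in>set (u @ v). i < x \<Longrightarrow> a \<ge> 1 \<Longrightarrow>
      good (surround i (nb a) (na a) u v) \<longleftrightarrow> good (u @ v) \<and> ok u v"
    and surround_exists: "good w \<Longrightarrow> i \<in> set w \<Longrightarrow> \<forall>x\<in>set w. i \<le> x \<Longrightarrow>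
      \<exists>u v b c. w = surround i b c u v \<and> i \<notin> set (u @ v) \<and>
        b = nb (count (mset w) i) \<and> c = na (count (mset w) i)"
    and rank_exists: "\<forall>x\<in>set w. i < x \<Longrightarrow> a \<ge> 1 \<Longrightarrow>
      \<exists>rank. bij_betw rank (split_points ok w) {1..card (split_points ok w)} \<and>
        (\<forall>p\<in>split_points ok w.
          card (split_points ok (surround i (nb a) (na a) (take p w) (drop p w))) =
          child a (card (split_points ok w)) (rank p))"
begin

text \<open>A bare count would not close the induction, since the number of children depends on the
  label of each word. The arbitrary weight \<open>\<phi>\<close> of the label captures the whole
  distribution of labels.\<close>

lemma sum_good_words_insert:
  assumes less: "\<forall>x\<in>#S. i < x" and a: "a \<ge> 1"
  shows "(\<Sum>w\<in>good_words good (S + replicate_mset a i). \<phi> (card (split_points ok w))) =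
    (\<Sum>w\<in>good_words good S. \<Sum>r\<in>{1..card (split_points ok w)}.
       \<phi> (child a (card (split_points ok w)) r))"
proof -
  define ins where "ins = (\<lambda>(w, p). surround i (nb a) (na a) (take p w) (drop p w))"
  let ?D = "SIGMA w:good_words good S. split_points ok w"
  have fb: "nb a \<ge> 1" "nb a + na a = a"
    using counts[OF a] by auto
  have set: "set w = set_mset S" if "w \<in> good_words good S" for w
    using that by (auto simp: good_words_def permutations_of_multiset_def)
  have bij: "bij_betw ins ?D (good_words good (S + replicate_mset a i))"
  \<comment> \<open>Deleting the copies of \<open>i\<close> recovers the old word, and the letters
    before the first copy recover the position; \<open>nb a \<ge> 1\<close> guarantees that a copy
    stands there.\<close>
  proof (rule bij_betw_byWitness[of _ "\<lambda>w. (filter (\<lambda>x. x \<noteq> i) w, length (takeWhile (\<lambda>x. x \<noteq> i) w))"])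
    show "\<forall>d\<in>?D. (filter (\<lambda>x. x \<noteq> i) (ins d), length (takeWhile (\<lambda>x. x \<noteq> i) (ins d))) = d"
    proof
      fix d assume "d \<in> ?D"
      then obtain w p where d: "d = (w, p)" "w \<in> good_words good S" "p \<le> length w"
        by (auto simp: split_points_def)
      then have "i \<notin> set w"
        using less set by auto
      then have "i \<notin> set (take p w @ drop p w)" "i \<notin> set (take p w)"
        by (auto dest: in_set_takeD)
      from filter_surround[OF this(1)] takeWhile_surround[OF this(2) fb(1)]
      show "(filter (\<lambda>x. x \<noteq> i) (ins d), length (takeWhile (\<lambda>x. x \<noteq> i) (ins d))) = d"
        using d(3) by (simp add: ins_def d(1))
    qed
    show "ins ` ?D \<subseteq> good_words good (S + replicate_mset a i)"
    proof
      fix w' assume "w' \<in> ins ` ?D"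
      then obtain w p where w: "w' = surround i (nb a) (na a) (take p w) (drop p w)"
        "w \<in> good_words good S" "p \<in> split_points ok w"
        by (auto simp: ins_def)
      have "mset w' = mset (take p w @ drop p w) + replicate_mset (nb a + na a) i"
        unfolding w(1) by (rule mset_surround)
      then have "mset w' = S + replicate_mset a i"
        using w(2) fb(2) by (simp add: good_words_def permutations_of_multiset_def)
      moreover have "good w'"
        using w set[OF w(2)] less a
        by (simp add: good_surround good_words_def split_points_def)
      ultimately show "w' \<in> good_words good (S + replicate_mset a i)"
        by (simp add: good_words_def permutations_of_multiset_def)
    qed
    have *: "\<exists>u v. w = surround i (nb a) (na a) u v \<and> u @ v \<in> good_words good S \<and>
        length u \<in> split_points ok (u @ v) \<and> i \<notin> set (u @ v)"
      if "w \<in> good_words good (S + replicate_mset a i)" for w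
    proof -
      have w: "good w" "mset w = S + replicate_mset a i"
        using that by (auto simp: good_words_def permutations_of_multiset_def)
      have "count S i = 0"
        using less by (auto simp: count_eq_zero_iff)
      then have count: "count (mset w) i = a"
        by (simp add: w(2))
      have "set w = set_mset S \<union> {i}"
        using a by (auto simp: w(2) simp flip: set_mset_mset)
      then obtain u v where uv: "w = surround i (nb a) (na a) u v" "i \<notin> set (u @ v)"
        using surround_exists[OF w(1), of i] less count by (auto simp: le_less)
      have "mset w = mset (u @ v) + replicate_mset (nb a + na a) i"
        unfolding uv(1) by (rule mset_surround)
      then have mset: "mset (u @ v) = S"
        using w(2) fb(2) by simp
      then have "\<forall>x\<in>set (u @ v). i < x"
        using less by (simp flip: set_mset_mset)
      then have "good (u @ v)" "ok u v"
        using good_surround a w(1) uv(1) by blast+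
      then show ?thesis
        using uv mset by (intro exI[of _ u] exI[of _ v])
          (simp add: good_words_def permutations_of_multiset_def split_points_def)
    qed
    show "\<forall>w\<in>good_words good (S + replicate_mset a i).
        ins (filter (\<lambda>x. x \<noteq> i) w, length (takeWhile (\<lambda>x. x \<noteq> i) w)) = w"
    proof
      fix w assume "w \<in> good_words good (S + replicate_mset a i)"
      then obtain u v where "w = surround i (nb a) (na a) u v" "i \<notin> set (u @ v)"
        using * by blast
      then show "ins (filter (\<lambda>x. x \<noteq> i) w, length (takeWhile (\<lambda>x. x \<noteq> i) w)) = w"
        using fb by (simp add: filter_surround takeWhile_surround ins_def)
    qed
    show "(\<lambda>w. (filter (\<lambda>x. x \<noteq> i) w, length (takeWhile (\<lambda>x. x \<noteq> i) w))) `
        good_words good (S + replicate_mset a i) \<subseteq> ?D"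
    proof
      fix d assume "d \<in> (\<lambda>w. (filter (\<lambda>x. x \<noteq> i) w, length (takeWhile (\<lambda>x. x \<noteq> i) w))) `
        good_words good (S + replicate_mset a i)"
      then obtain w where w: "w \<in> good_words good (S + replicate_mset a i)"
        "d = (filter (\<lambda>x. x \<noteq> i) w, length (takeWhile (\<lambda>x. x \<noteq> i) w))"
        by blast
      from *[OF w(1)] obtain u v where uv: "w = surround i (nb a) (na a) u v"
        "u @ v \<in> good_words good S" "length u \<in> split_points ok (u @ v)" "i \<notin> set (u @ v)"
        by blast
      then have "d = (u @ v, length u)"
        using fb by (simp add: w(2) filter_surround takeWhile_surround)
      then show "d \<in> ?D"
        using uv by simp
    qed
  qed
  have "(\<Sum>w\<in>good_words good (S + replicate_mset a i). \<phi> (card (split_points ok w))) =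
      (\<Sum>d\<in>?D. \<phi> (card (split_points ok (ins d))))"
    by (rule sum.reindex_bij_betw[OF bij, symmetric])
  also have "\<dots> = (\<Sum>w\<in>good_words good S. \<Sum>p\<in>split_points ok w. \<phi> (card (split_points ok (ins (w, p)))))"
    by (simp add: sum.Sigma case_prod_beta')
  also have "\<dots> = (\<Sum>w\<in>good_words good S. \<Sum>r\<in>{1..card (split_points ok w)}.
       \<phi> (child a (card (split_points ok w)) r))"
  proof (rule sum.cong[OF refl])
    fix w assume "w \<in> good_words good S"
    then have "\<forall>x\<in>set w. i < x"
      using less set by simp
    from rank_exists[OF this a] obtain rank where
      rank: "bij_betw rank (split_points ok w) {1..card (split_points ok w)}"
        "\<forall>p\<in>split_points ok w. card (split_points ok (ins (w, p))) =
          child a (card (split_points ok w)) (rank p)"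
      unfolding ins_def prod.case by blast
    have "(\<Sum>p\<in>split_points ok w. \<phi> (card (split_points ok (ins (w, p))))) =
        (\<Sum>p\<in>split_points ok w. \<phi> (child a (card (split_points ok w)) (rank p)))"
      using rank(2) by simp
    also have "\<dots> = (\<Sum>r\<in>{1..card (split_points ok w)}. \<phi> (child a (card (split_points ok w)) r))"
      by (rule sum.reindex_bij_betw[OF rank(1)])
    finally show "(\<Sum>p\<in>split_points ok w. \<phi> (card (split_points ok (ins (w, p))))) =
        (\<Sum>r\<in>{1..card (split_points ok w)}. \<phi> (child a (card (split_points ok w)) r))" .
  qed
  finally show ?thesis .
qed

lemma sum_good_words_empty: "(\<Sum>w\<in>good_words good {#}. \<phi> (card (split_points ok w))) = \<phi> 1"
proof -
  have "good_words good {#} = {[]}" "split_points ok [] = {0}"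
    using good_Nil ok_Nil by (auto simp: good_words_def split_points_def)
  then show ?thesis by simp
qed

end

text \<open>Both trees have root label 1 and the same child rule, so their label distributions agree
  level by level. Summing a weight over all children of a word gives a weight of its own label, and
  to this weight the induction hypothesis applies.\<close>

lemma card_good_words_eq:
  assumes "smallest_letter_insertion good nb na ok child"
    and "smallest_letter_insertion good' nb' na' ok' child"
  shows "card (good_words good S) = card (good_words good' S)"
proof -
  interpret I: smallest_letter_insertion good nb na ok child by fact
  interpret I': smallest_letter_insertion good' nb' na' ok' child by fact
  have "(\<Sum>w\<in>good_words good S. \<phi> (card (split_points ok w))) =
      (\<Sum>w\<in>good_words good' S. \<phi> (card (split_points ok' w)))" for \<phi> :: "nat \<Rightarrow> nat"
  proof (induction "size S" arbitrary: S \<phi> rule: less_induct)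
    case (less S)
    show ?case
    proof (cases "S = {#}")
      case True
      then show ?thesis
        by (simp only: I.sum_good_words_empty I'.sum_good_words_empty)
    next
      case False
      define i where "i = Min (set_mset S)"
      define a where "a = count S i"
      define T where "T = filter_mset (\<lambda>x. x \<noteq> i) S"
      have i: "i \<in># S" "\<forall>x\<in>#T. i < x"
        using False by (auto simp: i_def T_def less_le)
      then have a: "a \<ge> 1"
        by (simp add: a_def Suc_le_eq)
      have S: "S = T + replicate_mset a i"
        by (rule multiset_eqI) (auto simp: T_def a_def)
      have "size T < size S"
        using a by (subst S) simp
      from less.hyps[OF this, of "\<lambda>n. \<Sum>r = 1..n. \<phi> (child a n r)"]
      show ?thesis
        unfolding S I.sum_good_words_insert[OF i(2) a] I'.sum_good_words_insert[OF i(2) a] .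
    qed
  qed
  from this[of "\<lambda>_. 1"] show ?thesis by simp
qed

section \<open>Shape of words avoiding 121 or 112, and counting their positions\<close>

lemma surround_exists_121:
  assumes "avoids w [1,2,1]" "i \<in> set w" "\<forall>x\<in>set w. i \<le> x"
  shows "\<exists>u v. w = surround i (count (mset w) i) 0 u v \<and> i \<notin> set (u @ v)"
proof -
  obtain u w' where w: "w = u @ i # w'" "i \<notin> set u"
    using split_list_first[OF assms(2)] by blast
  define n where "n = length (takeWhile (\<lambda>x. x = i) w')"
  define v where "v = dropWhile (\<lambda>x. x = i) w'"
  have "takeWhile (\<lambda>x. x = i) w' = replicate n i"
    unfolding n_def by (intro replicate_eqI) (auto dest: set_takeWhileD)
  then have "w' = replicate n i @ v"
    using takeWhile_dropWhile_id[of "\<lambda>x. x = i" w'] by (simp add: v_def)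
  then have w_eq: "w = u @ i # replicate n i @ v"
    using w by simp
  \<comment> \<open>Otherwise the first letter after the run of \<open>i\<close> would lie between
    two copies of \<open>i\<close> and give 121.\<close>
  have "i \<notin> set v"
  proof
    assume "i \<in> set v"
    then obtain z v' where v: "v = z # v'"
      by (cases v) auto
    then have "z \<noteq> i"
      using hd_dropWhile[of "\<lambda>x. x = i" w'] by (simp add: v_def)
    then have "i < z" "i \<in> set v'"
      using assms(3) \<open>i \<in> set v\<close> w_eq v by (auto simp: le_less)
    have "subseq [i, z, i] (u @ i # replicate n i @ z # v')"
      using \<open>i \<in> set v'\<close> by (intro subseq_drop_many subseq_Cons2) (simp add: subseq_singleton_left)
    moreover have "same_order [i, z, i] [1,2,1]"
      using \<open>i < z\<close> by (auto simp: same_order_length3)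
    ultimately show False
      using assms(1) w_eq v unfolding contains_pattern_iff_subseq by blast
  qed
  moreover have "count (mset w) i = Suc n"
    using w(2) \<open>i \<notin> set v\<close> by (simp add: w_eq count_mset_0_iff)
  ultimately show ?thesis
    using w(2) by (intro exI[of _ u] exI[of _ v]) (simp add: w_eq surround_def)
qed

lemma surround_exists_112:
  assumes "avoids w [1,1,2]" "i \<in> set w" "\<forall>x\<in>set w. i \<le> x"
  shows "\<exists>u v. w = surround i 1 (count (mset w) i - 1) u v \<and> i \<notin> set (u @ v)"
proof -
  obtain u w' where w: "w = u @ i # w'" "i \<notin> set u"
    using split_list_first[OF assms(2)] by blast
  define v where "v = takeWhile (\<lambda>x. x \<noteq> i) w'"
  define t where "t = dropWhile (\<lambda>x. x \<noteq> i) w'"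
  have w_eq: "w = u @ i # v @ t"
    using w by (simp add: v_def t_def)
  have v: "i \<notin> set v"
    by (auto simp: v_def dest: set_takeWhileD)
  \<comment> \<open>A larger letter in \<open>t\<close> would follow two copies of \<open>i\<close>:
    the one after \<open>u\<close> and the first letter of \<open>t\<close>.\<close>
  have "x = i" if "x \<in> set t" for x
  proof (rule ccontr)
    assume "x \<noteq> i"
    then have "i < x"
      using assms(3) that by (auto simp: w_eq le_less)
    have "t \<noteq> []"
      using that by auto
    then have "hd t = i"
      using hd_dropWhile[of "\<lambda>x. x \<noteq> i" w'] by (simp add: t_def)
    then obtain t' where t: "t = i # t'"
      using \<open>t \<noteq> []\<close> by (cases t) auto
    then have "subseq [i, i, x] (u @ i # v @ i # t')"
      using that \<open>x \<noteq> i\<close> by (intro subseq_drop_many subseq_Cons2) (simp add: subseq_singleton_left)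
    moreover have "same_order [i, i, x] [1,1,2]"
      using \<open>i < x\<close> by (auto simp: same_order_length3)
    ultimately show False
      using assms(1) w_eq t unfolding contains_pattern_iff_subseq by blast
  qed
  then have t: "t = replicate (length t) i"
    by (intro replicate_eqI) auto
  then have "count (mset t) i = length t"
    by (metis count_replicate_mset mset_replicate)
  then have "count (mset w) i - 1 = length t"
    using w(2) v by (simp add: w_eq count_mset_0_iff)
  then show ?thesis
    using w(2) v t by (intro exI[of _ u] exI[of _ v]) (simp add: w_eq surround_def)
qed

text \<open>The position between \<open>xs\<close> and \<open>ys\<close> is counted on the side of
  \<open>ys\<close>, hence the strict bound in the first set.\<close>

lemma card_split_points_append:
  "card (split_points ok (xs @ ys)) =
     card {q. q < length xs \<and> ok (take q xs) (drop q xs @ ys)} +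
     card (split_points (\<lambda>u. ok (xs @ u)) ys)"
proof -
  let ?A = "{q. q < length xs \<and> ok (take q xs) (drop q xs @ ys)}"
  let ?B = "split_points (\<lambda>u. ok (xs @ u)) ys"
  have "split_points ok (xs @ ys) = ?A \<union> (+) (length xs) ` ?B"
  proof (intro set_eqI iffI)
    fix q assume q: "q \<in> split_points ok (xs @ ys)"
    show "q \<in> ?A \<union> (+) (length xs) ` ?B"
    proof (cases "q < length xs")
      case False
      then have "q = length xs + (q - length xs)" "q - length xs \<in> ?B"
        using q by (auto simp: split_points_def)
      then show ?thesis by blast
    qed (use q in \<open>simp add: split_points_def\<close>)
  qed (auto simp: split_points_def)
  moreover have "card (?A \<union> (+) (length xs) ` ?B) = card ?A + card ((+) (length xs) ` ?B)"
    by (rule card_Un_disjoint) auto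
  ultimately show ?thesis
    by (simp add: card_image)
qed

text \<open>Only the last of the four blocks includes its right end, which is the position at the
  end of the word.\<close>

lemma card_split_points_surround:
  "card (split_points ok (surround i b c u v)) =
     card {q. q < length u \<and> ok (take q u) (drop q u @ replicate b i @ v @ replicate c i)} +
     card {q. q < b \<and> ok (u @ replicate q i) (replicate (b - q) i @ v @ replicate c i)} +
     card {q. q < length v \<and> ok (u @ replicate b i @ take q v) (drop q v @ replicate c i)} +
     card {q. q \<le> c \<and> ok (u @ replicate b i @ v @ replicate q i) (replicate (c - q) i)}"
proof -
  have "{q. q < b \<and> ok (u @ take q (replicate b i)) (drop q (replicate b i) @ w)} =
      {q. q < b \<and> ok (u @ replicate q i) (replicate (b - q) i @ w)}" for w
    by (auto simp: min_def)
  moreover have "split_points ok' (replicate c i) =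
      {q. q \<le> c \<and> ok' (replicate q i) (replicate (c - q) i)}" for ok'
    by (auto simp: split_points_def min_def)
  ultimately show ?thesis
    unfolding surround_def card_split_points_append by simp
qed

lemma bij_betw_rank:
  fixes A :: "nat set"
  assumes "finite A"
  shows "bij_betw (\<lambda>p. card {q \<in> A. q \<le> p}) A {1..card A}"
proof -
  have less: "card {q \<in> A. q \<le> p} < card {q \<in> A. q \<le> p'}" if "p < p'" "p' \<in> A" for p p'
  proof (rule psubset_card_mono)
    have "p' \<in> {q \<in> A. q \<le> p'} - {q \<in> A. q \<le> p}"
      using that by simp
    moreover have "{q \<in> A. q \<le> p} \<subseteq> {q \<in> A. q \<le> p'}"
      using that by auto
    ultimately show "{q \<in> A. q \<le> p} \<subset> {q \<in> A. q \<le> p'}"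
      by blast
  qed (use assms in simp)
  have inj: "inj_on (\<lambda>p. card {q \<in> A. q \<le> p}) A"
  proof (rule linorder_inj_onI')
    show "card {q \<in> A. q \<le> p} \<noteq> card {q \<in> A. q \<le> p'}" if "p' \<in> A" "p < p'" for p p'
      using less[OF that(2,1)] by simp
  qed
  have "card {q \<in> A. q \<le> p} \<in> {1..card A}" if "p \<in> A" for p
  proof -
    have "card {q \<in> A. q \<le> p} > 0"
      using assms that by (subst card_gt_0_iff) auto
    moreover have "card {q \<in> A. q \<le> p} \<le> card A"
      using assms by (intro card_mono) auto
    ultimately show ?thesis by simp
  qed
  then have "(\<lambda>p. card {q \<in> A. q \<le> p}) ` A \<subseteq> {1..card A}"
    by blast
  moreover have "card ((\<lambda>p. card {q \<in> A. q \<le> p}) ` A) = card {1..card A}"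
    using inj by (simp add: card_image)
  ultimately have "(\<lambda>p. card {q \<in> A. q \<le> p}) ` A = {1..card A}"
    by (intro card_subset_eq) simp_all
  then show ?thesis
    using inj by (simp add: bij_betw_def)
qed

lemma rank_max_iff:
  fixes A :: "nat set"
  assumes "finite A" "n \<in> A" "\<forall>q\<in>A. q \<le> n" "p \<in> A"
  shows "card {q \<in> A. q \<le> p} = card A \<longleftrightarrow> p = n"
proof
  assume "card {q \<in> A. q \<le> p} = card A"
  then have "{q \<in> A. q \<le> p} = A"
    using assms(1) by (intro card_subset_eq) auto
  then have "n \<le> p"
    using assms(2) by blast
  then show "p = n"
    using assms(3,4) by (simp add: antisym)
next
  assume "p = n"
  then have "{q \<in> A. q \<le> p} = A"
    using assms(3) by auto
  then show "card {q \<in> A. q \<le> p} = card A" by simp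
qed

lemma upper_segment_eq:
  fixes A :: "nat set"
  assumes "n \<in> A" "\<forall>q\<in>A. q \<le> n" "\<And>p q. p \<in> A \<Longrightarrow> p \<le> q \<Longrightarrow> q \<le> n \<Longrightarrow> q \<in> A"
  shows "A = {n + 1 - card A..n}" "card A \<le> n + 1" "card A \<ge> 1"
proof -
  have "finite A"
    using assms(2) by (intro finite_subset[of A "{..n}"]) auto
  define m where "m = Min A"
  have m: "m \<in> A" "\<And>q. q \<in> A \<Longrightarrow> m \<le> q"
    using \<open>finite A\<close> assms(1) by (auto simp: m_def intro!: Min_in)
  have A: "A = {m..n}"
  proof (intro set_eqI iffI)
    show "q \<in> {m..n}" if "q \<in> A" for q
      using that m(2) assms(2) by simp
    show "q \<in> A" if "q \<in> {m..n}" for q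
      using that m(1) assms(3)[of m q] by simp
  qed
  have "m \<le> n"
    using m(1) assms(2) by blast
  then show "A = {n + 1 - card A..n}" "card A \<le> n + 1" "card A \<ge> 1"
    unfolding A by simp_all
qed

lemma insertion_avoiding_121I:
  assumes "\<And>w. good w \<Longrightarrow> avoids w [1,2,1]" "good []" "ok [] []"
    and "\<And>i a u v. \<forall>x\<in>set (u @ v). i < x \<Longrightarrow> a \<ge> 1 \<Longrightarrow>
      good (surround i a 0 u v) \<longleftrightarrow> good (u @ v) \<and> ok u v"
    and "\<And>i a w. \<forall>x\<in>set w. i < x \<Longrightarrow> a \<ge> 1 \<Longrightarrow>
      \<exists>rank. bij_betw rank (split_points ok w) {1..card (split_points ok w)} \<and>
        (\<forall>p\<in>split_points ok w. card (split_points ok (surround i a 0 (take p w) (drop p w))) =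
          child a (card (split_points ok w)) (rank p))"
  shows "smallest_letter_insertion good (\<lambda>a. a) (\<lambda>a. 0) ok child"
proof
  fix w :: word and i :: nat
  assume "good w" "i \<in> set w" "\<forall>x\<in>set w. i \<le> x"
  then show "\<exists>u v b c. w = surround i b c u v \<and> i \<notin> set (u @ v) \<and> b = count (mset w) i \<and> c = 0"
    using surround_exists_121[of w i] assms(1) by blast
qed (use assms(2-) in simp_all)

lemma insertion_avoiding_112I:
  assumes "\<And>w. good w \<Longrightarrow> avoids w [1,1,2]" "good []" "ok [] []"
    and "\<And>i a u v. \<forall>x\<in>set (u @ v). i < x \<Longrightarrow> a \<ge> 1 \<Longrightarrow>
      good (surround i 1 (a - 1) u v) \<longleftrightarrow> good (u @ v) \<and> ok u v"
    and "\<And>i a w. \<forall>x\<in>set w. i < x \<Longrightarrow> a \<ge> 1 \<Longrightarrow>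
      \<exists>rank. bij_betw rank (split_points ok w) {1..card (split_points ok w)} \<and>
        (\<forall>p\<in>split_points ok w. card (split_points ok (surround i 1 (a - 1) (take p w) (drop p w))) =
          child a (card (split_points ok w)) (rank p))"
  shows "smallest_letter_insertion good (\<lambda>a. 1) (\<lambda>a. a - 1) ok child"
proof
  fix w :: word and i :: nat
  assume "good w" "i \<in> set w" "\<forall>x\<in>set w. i \<le> x"
  then show "\<exists>u v b c. w = surround i b c u v \<and> i \<notin> set (u @ v) \<and> b = 1 \<and> c = count (mset w) i - 1"
    using surround_exists_112[of w i] assms(1) by blast
qed (use assms(2-) in simp_all)

lemma avoids_Nil: "avoids [] [p, q, r]"
  by (simp add: contains_pattern_length3)

section \<open>Child rules of the individual trees\<close>

lemma split_points_True: "split_points (\<lambda>u v. True) w = {..length w}"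
  by (auto simp: split_points_def)

text \<open>Every gap is allowed, so the label is the length plus one, and it grows by the number of
  inserted letters whatever the position.\<close>

lemma rank_exists_unrestricted:
  "\<exists>rank. bij_betw rank (split_points (\<lambda>u v. True) w) {1..card (split_points (\<lambda>u v. True) w)} \<and>
     (\<forall>p\<in>split_points (\<lambda>u v. True) w.
       card (split_points (\<lambda>u v. True) (surround i b c (take p w) (drop p w))) =
       card (split_points (\<lambda>u v. True) w) + (b + c))"
proof (intro exI conjI ballI)
  show "bij_betw Suc (split_points (\<lambda>u v. True) w) {1..card (split_points (\<lambda>u v. True) w)}"
    by (simp add: split_points_True bij_betw_def image_Suc_atMost)
qed (simp add: split_points_True surround_def)

lemma insertion_121:
  "smallest_letter_insertion (\<lambda>w. \<forall>\<rho>\<in>{[1,2,1]}. avoids w \<rho>) (\<lambda>a. a) (\<lambda>a. 0)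
     (\<lambda>u v. True) (\<lambda>a n r. n + a)"
proof (rule insertion_avoiding_121I, goal_cases)
  case (4 i a u v)
  then show ?case
    using avoids_121_surround[of u v i a 0] by simp
next
  case (5 i a w)
  then show ?case
    using rank_exists_unrestricted[of w i a 0] by simp
qed (simp_all add: avoids_Nil)

lemma insertion_112:
  "smallest_letter_insertion (\<lambda>w. \<forall>\<rho>\<in>{[1,1,2]}. avoids w \<rho>) (\<lambda>a. 1) (\<lambda>a. a - 1)
     (\<lambda>u v. True) (\<lambda>a n r. n + a)"
proof (rule insertion_avoiding_112I, goal_cases)
  case (4 i a u v)
  then show ?case
    using avoids_112_surround[of u v i 1 "a - 1"] by simp
next
  case (5 i a w)
  then show ?case
    using rank_exists_unrestricted[of w i 1 "a - 1"] by simp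
qed (simp_all add: avoids_Nil)

lemma length_in_split_points: "ok w [] \<Longrightarrow> length w \<in> split_points ok w"
  by (simp add: split_points_def)

lemma drop_take_append_drop: "q \<le> p \<Longrightarrow> drop q (take p w) @ drop p w = drop q w"
  by (metis append_take_drop_id drop_drop drop_take le_add_diff_inverse2)

text \<open>Positions to the left of the insertion keep their status whenever the inserted letters
  do not influence \<open>ok\<close> there.\<close>

lemma split_points_before:
  assumes "p \<le> length w"
    and "\<And>q. q < p \<Longrightarrow> ok (take q w) (drop q (take p w) @ xs) \<longleftrightarrow>
      ok (take q w) (drop q (take p w) @ drop p w)"
  shows "{q. q < length (take p w) \<and> ok (take q (take p w)) (drop q (take p w) @ xs)} =
    {q \<in> split_points ok w. q < p}"
  using assms by (auto simp: split_points_def min_def drop_take_append_drop)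

lemma rank_eq_Suc:
  fixes A :: "nat set"
  assumes "finite A" "p \<in> A"
  shows "card {q \<in> A. q \<le> p} = Suc (card {q \<in> A. q < p})"
proof -
  have "{q \<in> A. q \<le> p} = insert p {q \<in> A. q < p}"
    using assms(2) by auto
  then show ?thesis
    using assms(1) by simp
qed

text \<open>Two enumerations of an upper segment from the right. The second shifts the first
  cyclically, so that the end position \<open>n\<close> gets the largest rank instead of the
  smallest.\<close>

lemma bij_betw_corank:
  fixes A :: "nat set"
  assumes "n \<in> A" "\<forall>q\<in>A. q \<le> n" "\<And>p q. p \<in> A \<Longrightarrow> p \<le> q \<Longrightarrow> q \<le> n \<Longrightarrow> q \<in> A"
  shows "bij_betw (\<lambda>p. n + 1 - p) A {1..card A}"
    and "bij_betw (\<lambda>p. if p = n then card A else n - p) A {1..card A}"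
    and "p \<in> A \<Longrightarrow> p < n \<Longrightarrow> n - p < card A"
proof -
  obtain m where m: "card A = m" by simp
  have A: "A = {n + 1 - m..n}" "m \<le> n + 1" "m \<ge> 1"
    using upper_segment_eq[of n A] assms m by blast+
  show "bij_betw (\<lambda>p. n + 1 - p) A {1..card A}"
    unfolding m unfolding A(1)
    by (rule bij_betw_byWitness[of _ "\<lambda>r. n + 1 - r"]) (use A(2,3) in auto)
  show "bij_betw (\<lambda>p. if p = n then card A else n - p) A {1..card A}"
    unfolding m unfolding A(1)
    by (rule bij_betw_byWitness[of _ "\<lambda>r. if r = m then n else n - r"]) (use A(2,3) in auto)
  show "p \<in> A \<Longrightarrow> p < n \<Longrightarrow> n - p < card A"
    unfolding m unfolding A(1) using A(2,3) by auto
qed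

text \<open>Behind an inserted smallest letter no position is allowed while a larger letter still
  follows. So an insertion before the end leaves the positions up to \<open>p\<close> and the end of
  the word. At the end of the word all positions survive and each copy adds one.\<close>

lemma rank_exists_dominating:
  fixes w :: word
  defines "ok \<equiv> \<lambda>u v. \<forall>y\<in>set u. \<forall>z\<in>set v. z \<le> (y::nat)"
  assumes less: "\<forall>x\<in>set w. i < x" and a: "a \<ge> 1"
  shows "\<exists>rank. bij_betw rank (split_points ok w) {1..card (split_points ok w)} \<and>
    (\<forall>p\<in>split_points ok w. card (split_points ok (surround i a 0 (take p w) (drop p w))) =
      (if rank p = card (split_points ok w) then card (split_points ok w) + a else rank p + 1))"
proof (intro exI conjI ballI)
  let ?A = "split_points ok w"
  let ?rank = "\<lambda>p. card {q \<in> ?A. q \<le> p}"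
  show "bij_betw ?rank ?A {1..card ?A}"
    by (rule bij_betw_rank) simp
  fix p assume p: "p \<in> ?A"
  define u v where "u = take p w" and "v = drop p w"
  have p_le: "p \<le> length w" and uv: "ok u v"
    using p by (auto simp: split_points_def u_def v_def)
  have le: "\<forall>x\<in>set u. i \<le> x" "\<forall>x\<in>set v. i < x"
    using less by (auto simp: u_def v_def le_less dest: in_set_takeD in_set_dropD)
  have v_Nil: "v = [] \<longleftrightarrow> p = length w"
    using p_le by (auto simp: v_def)
  have "{q. q < length u \<and> ok (take q u) (drop q u @ replicate a i @ v @ replicate 0 i)} =
      {q \<in> ?A. q < p}"
    unfolding u_def
  proof (rule split_points_before[OF p_le])
    fix q
    have "\<forall>x\<in>set (take q w). i \<le> x"
      using less by (auto simp: le_less dest: in_set_takeD)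
    then show "ok (take q w) (drop q (take p w) @ replicate a i @ v @ replicate 0 i) \<longleftrightarrow>
        ok (take q w) (drop q (take p w) @ drop p w)"
      using a by (auto simp: ok_def v_def)
  qed
  moreover have "{q. q < a \<and> ok (u @ replicate q i) (replicate (a - q) i @ v @ replicate 0 i)} =
      (if v = [] then {..<a} else {0})"
    using le uv a by (cases v) (auto simp: ok_def set_replicate_conv_if split: if_splits)
  moreover have "{q. q < length v \<and> ok (u @ replicate a i @ take q v) (drop q v @ replicate 0 i)} = {}"
  proof -
    have "\<not> ok (u @ replicate a i @ take q v) (drop q v)" if "q < length v" for q
    proof -
      have "v ! q \<in> set (drop q v)" "v ! q \<in> set v"
        using that by (simp_all flip: Cons_nth_drop_Suc)
      moreover have "i \<in> set (u @ replicate a i @ take q v)"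
        using a by simp
      ultimately show ?thesis
        using le(2) unfolding ok_def by (meson leD)
    qed
    then show ?thesis by auto
  qed
  moreover have "{q. q \<le> 0 \<and> ok (u @ replicate a i @ v @ replicate q i) (replicate (0 - q) i)} = {0}"
    by (auto simp: ok_def)
  ultimately have "card (split_points ok (surround i a 0 u v)) =
      card {q \<in> ?A. q < p} + (if v = [] then a else 1) + 1"
    unfolding card_split_points_surround by simp
  also have "\<dots> = ?rank p + (if v = [] then a else 1)"
    using p by (simp add: rank_eq_Suc)
  finally have card: "card (split_points ok (surround i a 0 u v)) = ?rank p + (if v = [] then a else 1)" .
  have "length w \<in> ?A"
    by (rule length_in_split_points) (simp add: ok_def)
  moreover have "\<forall>q\<in>?A. q \<le> length w"
    by (simp add: split_points_def)
  ultimately have "?rank p = card ?A \<longleftrightarrow> p = length w"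
    using p by (intro rank_max_iff) simp_all
  then show "card (split_points ok (surround i a 0 (take p w) (drop p w))) =
      (if ?rank p = card ?A then card ?A + a else ?rank p + 1)"
    using card v_Nil unfolding u_def v_def by (cases "p = length w") simp_all
qed

text \<open>A cut may not separate two copies of \<open>i\<close>. With further copies at the end,
  this leaves the positions up to \<open>p\<close> and the end of the word. A single copy forbids
  nothing and splits the chosen position into two.\<close>

lemma rank_exists_disjoint:
  fixes w :: word
  defines "ok \<equiv> \<lambda>u v :: word. set u \<inter> set v = {}"
  assumes less: "\<forall>x\<in>set w. i < x" and a: "a \<ge> 1"
  shows "\<exists>rank. bij_betw rank (split_points ok w) {1..card (split_points ok w)} \<and>
    (\<forall>p\<in>split_points ok w. card (split_points ok (surround i 1 (a - 1) (take p w) (drop p w))) =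
      (if a = 1 then card (split_points ok w) + 1 else rank p + 1))"
proof (intro exI conjI ballI)
  let ?A = "split_points ok w"
  let ?rank = "\<lambda>p. card {q \<in> ?A. q \<le> p}"
  show "bij_betw ?rank ?A {1..card ?A}"
    by (rule bij_betw_rank) simp
  fix p assume p: "p \<in> ?A"
  define u v c where "u = take p w" and "v = drop p w" and "c = a - 1"
  have p_le: "p \<le> length w" and uv: "ok u v"
    using p by (auto simp: split_points_def u_def v_def)
  have i: "i \<notin> set u" "i \<notin> set v"
    using less by (auto simp: u_def v_def dest: in_set_takeD in_set_dropD)
  have "{q. q < length u \<and> ok (take q u) (drop q u @ replicate 1 i @ v @ replicate c i)} =
      {q \<in> ?A. q < p}"
    unfolding u_def
  proof (rule split_points_before[OF p_le])
    fix q
    have "i \<notin> set (take q w)"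
      using less by (auto dest: in_set_takeD)
    then show "ok (take q w) (drop q (take p w) @ replicate 1 i @ v @ replicate c i) \<longleftrightarrow>
        ok (take q w) (drop q (take p w) @ drop p w)"
      by (auto simp: ok_def v_def split: if_splits)
  qed
  moreover have "{q. q < 1 \<and> ok (u @ replicate q i) (replicate (1 - q) i @ v @ replicate c i)} = {0}"
    using i uv by (auto simp: ok_def)
  moreover have "{q. q \<le> c \<and> ok (u @ replicate 1 i @ v @ replicate q i) (replicate (c - q) i)} = {c}"
    by (auto simp: ok_def)
  ultimately have card: "card (split_points ok (surround i 1 c u v)) = card {q \<in> ?A. q < p} + 1 +
      card {q. q < length v \<and> ok (u @ replicate 1 i @ take q v) (drop q v @ replicate c i)} + 1"
    unfolding card_split_points_surround by simp
  show "card (split_points ok (surround i 1 (a - 1) (take p w) (drop p w))) =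
      (if a = 1 then card ?A + 1 else ?rank p + 1)"
  proof (cases "a = 1")
    case False
    then have "{q. q < length v \<and> ok (u @ replicate 1 i @ take q v) (drop q v @ replicate c i)} = {}"
      using a by (auto simp: ok_def c_def)
    then show ?thesis
      using card False p by (simp add: rank_eq_Suc u_def v_def c_def)
  next
    case True
    \<comment> \<open>The old positions from \<open>p\<close> on are the positions behind the new
      letter, shifted by \<open>p\<close>; the end is listed separately because the block of
      \<open>v\<close> excludes its right end.\<close>
    have "{q \<in> ?A. \<not> q < p} =
        insert (length w) ((+) p ` {q. q < length v \<and> ok (u @ replicate 1 i @ take q v) (drop q v)})"
      (is "_ = insert _ (_ ` ?B)")
    proof (intro set_eqI iffI)
      have split: "ok (take (p + q) w) (drop (p + q) w) \<longleftrightarrow>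
          ok (u @ replicate 1 i @ take q v) (drop q v)" for q
      proof -
        have "take (p + q) w = u @ take q v" "drop (p + q) w = drop q v"
          by (simp_all add: take_add u_def v_def add.commute)
        then show ?thesis
          using i by (auto simp: ok_def dest: in_set_dropD)
      qed
      fix q
      show "q \<in> insert (length w) ((+) p ` ?B)" if q: "q \<in> {q \<in> ?A. \<not> q < p}"
      proof (cases "q = length w")
        case False
        then have "q = p + (q - p)" "q - p \<in> ?B"
          using q split[of "q - p"] by (auto simp: split_points_def v_def)
        then show ?thesis by blast
      qed simp
      show "q \<in> {q \<in> ?A. \<not> q < p}" if "q \<in> insert (length w) ((+) p ` ?B)"
        using that split p_le by (auto simp: split_points_def v_def ok_def)
    qed
    moreover have "length w \<notin> (+) p ` ?B"
      using p_le by (auto simp: v_def)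
    ultimately have "card {q \<in> ?A. \<not> q < p} = Suc (card ?B)"
      by (simp add: card_image)
    moreover have "card ?A = card {q \<in> ?A. q < p} + card {q \<in> ?A. \<not> q < p}"
      by (subst card_Un_disjoint[symmetric]) (auto intro: arg_cong[of _ _ card])
    ultimately show ?thesis
      using card True by (simp add: u_def v_def c_def)
  qed
qed

lemma upper_split_points:
  assumes "\<And>q v. Q v \<Longrightarrow> Q (drop q v)" "p \<in> split_points (\<lambda>u. Q) w" "p \<le> q" "q \<le> length w"
  shows "q \<in> split_points (\<lambda>u. Q) w"
  using assms(1)[of "drop p w" "q - p"] assms(2-) by (simp add: split_points_def)

lemma not_sorted_append_larger:
  fixes v :: word
  assumes "v \<noteq> []" "\<forall>x\<in>set v. i < x" "i \<in> set xs"
  shows "\<not> sorted_wrt (\<ge>) (xs @ v)"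
proof
  assume "sorted_wrt (\<ge>) (xs @ v)"
  then have "hd v \<le> i"
    using assms(1,3) by (simp add: sorted_wrt_append)
  moreover have "i < hd v"
    using assms(1,2) by simp
  ultimately show False by simp
qed

text \<open>The allowed positions form an upper segment. An insertion at the end keeps them all and
  adds \<open>a\<close>. Any other insertion is followed by a larger letter, so only the
  \<open>length v + 1\<close> positions behind the new block survive.\<close>

lemma rank_exists_decreasing:
  fixes w :: word
  defines "ok \<equiv> \<lambda>u v :: word. sorted_wrt (\<ge>) v"
  assumes less: "\<forall>x\<in>set w. i < x" and a: "a \<ge> 1"
  shows "\<exists>rank. bij_betw rank (split_points ok w) {1..card (split_points ok w)} \<and>
    (\<forall>p\<in>split_points ok w. card (split_points ok (surround i a 0 (take p w) (drop p w))) =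
      (if rank p = card (split_points ok w) then card (split_points ok w) + a else rank p + 1))"
proof (intro exI conjI ballI)
  let ?A = "split_points ok w" and ?n = "length w"
  have A: "?n \<in> ?A" "\<forall>q\<in>?A. q \<le> ?n" "\<And>p q. p \<in> ?A \<Longrightarrow> p \<le> q \<Longrightarrow> q \<le> ?n \<Longrightarrow> q \<in> ?A"
    unfolding ok_def using upper_split_points[of "sorted_wrt (\<ge>)" _ w]
    by (auto simp: split_points_def sorted_wrt_drop)
  \<comment> \<open>The value \<open>?n - p\<close> is the length of the suffix behind
    \<open>p\<close>. The end takes the top rank, since the child rule reserves the label with
    summand \<open>a\<close> for that rank.\<close>
  let ?rank = "\<lambda>p. if p = ?n then card ?A else ?n - p"
  show "bij_betw ?rank ?A {1..card ?A}"
    by (rule bij_betw_corank(2)[OF A])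
  fix p assume p: "p \<in> ?A"
  define u v where "u = take p w" and "v = drop p w"
  have p_le: "p \<le> ?n" and v: "sorted_wrt (\<ge>) v"
    using p by (auto simp: split_points_def v_def ok_def)
  have v_less: "\<forall>x\<in>set v. i < x"
    using less by (auto simp: v_def dest: in_set_dropD)
  show "card (split_points ok (surround i a 0 (take p w) (drop p w))) =
      (if ?rank p = card ?A then card ?A + a else ?rank p + 1)"
  proof (cases "p = ?n")
    case True
    have "{q. q < length u \<and> ok (take q u) (drop q u @ replicate a i @ v @ replicate 0 i)} =
        {q \<in> ?A. q < p}"
      unfolding u_def
    proof (rule split_points_before[OF p_le])
      fix q
      have "sorted_wrt (\<ge>) (replicate a i)"
        by (simp add: sorted_wrt_iff_nth_less)
      moreover have "\<forall>x\<in>set (drop q w). i \<le> x"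
        using less by (auto simp: le_less dest: in_set_dropD)
      ultimately show "ok (take q w) (drop q (take p w) @ replicate a i @ v @ replicate 0 i) \<longleftrightarrow>
          ok (take q w) (drop q (take p w) @ drop p w)"
        using True by (auto simp: ok_def v_def sorted_wrt_append)
    qed
    moreover have "{q. q < a \<and> ok (u @ replicate q i) (replicate (a - q) i @ v @ replicate 0 i)} = {..<a}"
      using True by (auto simp: ok_def v_def sorted_wrt_iff_nth_less)
    moreover have "{q. q \<le> 0 \<and> ok (u @ replicate a i @ v @ replicate q i) (replicate (0 - q) i)} = {0}"
      by (auto simp: ok_def)
    moreover have "length v = 0"
      using True by (simp add: v_def)
    ultimately have "card (split_points ok (surround i a 0 u v)) = Suc (card {q \<in> ?A. q < p}) + a"
      unfolding card_split_points_surround by simp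
    also have "\<dots> = card ?A + a"
      using p rank_max_iff[of ?A ?n p] A True by (simp add: rank_eq_Suc)
    finally show ?thesis
      using True by (simp add: u_def v_def)
  next
    case False
    then have "v \<noteq> []"
      using p_le by (simp add: v_def)
    note not_sorted = not_sorted_append_larger[OF this v_less]
    have "{q. q < length u \<and> ok (take q u) (drop q u @ replicate a i @ v @ replicate 0 i)} = {}"
      using not_sorted[of "drop _ u @ replicate a i"] a by (simp add: ok_def)
    moreover have "{q. q < a \<and> ok (u @ replicate q i) (replicate (a - q) i @ v @ replicate 0 i)} = {}"
      using not_sorted[of "replicate (a - _) i"] by (simp add: ok_def)
    moreover have "{q. q < length v \<and> ok (u @ replicate a i @ take q v) (drop q v @ replicate 0 i)} =
        {..<length v}"
      using v by (auto simp: ok_def sorted_wrt_drop)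
    moreover have "{q. q \<le> 0 \<and> ok (u @ replicate a i @ v @ replicate q i) (replicate (0 - q) i)} = {0}"
      by (auto simp: ok_def)
    ultimately have "card (split_points ok (surround i a 0 u v)) = length v + 1"
      unfolding card_split_points_surround by simp
    moreover have "?n - p < card ?A"
      using bij_betw_corank(3)[OF A p] p_le False by simp
    ultimately show ?thesis
      using False by (simp add: u_def v_def)
  qed
qed

text \<open>An allowed suffix contains at most one copy of \<open>i\<close>. For
  \<open>a \<ge> 2\<close> this leaves the position before the last copy and all those behind it,
  \<open>length v + 2\<close> in number. A single copy keeps every position and adds one.\<close>

lemma rank_exists_distinct:
  fixes w :: word
  defines "ok \<equiv> \<lambda>u v :: word. distinct v"
  assumes less: "\<forall>x\<in>set w. i < x" and a: "a \<ge> 1"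
  shows "\<exists>rank. bij_betw rank (split_points ok w) {1..card (split_points ok w)} \<and>
    (\<forall>p\<in>split_points ok w. card (split_points ok (surround i a 0 (take p w) (drop p w))) =
      (if a = 1 then card (split_points ok w) + 1 else rank p + 1))"
proof (intro exI conjI ballI)
  let ?A = "split_points ok w" and ?n = "length w"
  have A: "?n \<in> ?A" "\<forall>q\<in>?A. q \<le> ?n" "\<And>p q. p \<in> ?A \<Longrightarrow> p \<le> q \<Longrightarrow> q \<le> ?n \<Longrightarrow> q \<in> ?A"
    unfolding ok_def using upper_split_points[of distinct _ w]
    by (auto simp: split_points_def)
  let ?rank = "\<lambda>p. ?n + 1 - p"
  show "bij_betw ?rank ?A {1..card ?A}"
    by (rule bij_betw_corank(1)[OF A])
  fix p assume p: "p \<in> ?A"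
  define u v where "u = take p w" and "v = drop p w"
  have p_le: "p \<le> ?n" and v: "distinct v"
    using p by (auto simp: split_points_def v_def ok_def)
  have i: "i \<notin> set v" "i \<notin> set u"
    using less by (auto simp: u_def v_def dest: in_set_takeD in_set_dropD)
  have distinct_replicate: "distinct (replicate m i) \<longleftrightarrow> m \<le> 1" for m
    by (cases m; cases "m - 1") auto
  have "{q. q < a \<and> ok (u @ replicate q i) (replicate (a - q) i @ v @ replicate 0 i)} = {a - 1}"
    using v i a by (auto simp: ok_def distinct_replicate)
  moreover have "{q. q < length v \<and> ok (u @ replicate a i @ take q v) (drop q v @ replicate 0 i)} =
      {..<length v}"
    using v by (auto simp: ok_def)
  moreover have "{q. q \<le> 0 \<and> ok (u @ replicate a i @ v @ replicate q i) (replicate (0 - q) i)} = {0}"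
    by (auto simp: ok_def)
  ultimately have card: "card (split_points ok (surround i a 0 u v)) =
      card {q. q < length u \<and> ok (take q u) (drop q u @ replicate a i @ v @ replicate 0 i)} +
      length v + 2"
    unfolding card_split_points_surround by simp
  show "card (split_points ok (surround i a 0 (take p w) (drop p w))) =
      (if a = 1 then card ?A + 1 else ?rank p + 1)"
  proof (cases "a = 1")
    case False
    then have "{q. q < length u \<and> ok (take q u) (drop q u @ replicate a i @ v @ replicate 0 i)} = {}"
      using a by (auto simp: ok_def distinct_replicate)
    then have "card (split_points ok (surround i a 0 u v)) = length v + 2"
      unfolding card by (simp only: card.empty add_0)
    then show ?thesis
      using False p_le by (simp add: u_def v_def)
  next
    case True
    have "{q. q < length u \<and> ok (take q u) (drop q u @ replicate a i @ v @ replicate 0 i)} =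
        {q \<in> ?A. q < p}"
      unfolding u_def
    proof (rule split_points_before[OF p_le])
      fix q
      have "i \<notin> set (drop q (take p w))"
        using i(2) by (auto simp: u_def dest: in_set_dropD)
      then show "ok (take q w) (drop q (take p w) @ replicate a i @ v @ replicate 0 i) \<longleftrightarrow>
          ok (take q w) (drop q (take p w) @ drop p w)"
        using True i by (auto simp: ok_def v_def)
    qed
    moreover have "card ?A = card {q \<in> ?A. q < p} + card {p..?n}"
    proof -
      have "{p..?n} \<subseteq> ?A"
        using A(3)[OF p] by auto
      then have "card (?A - {p..?n}) = card ?A - card {p..?n}" "card {p..?n} \<le> card ?A"
        by (rule card_Diff_subset[OF finite_atLeastAtMost], rule card_mono[OF finite_split_points])
      moreover have "?A - {p..?n} = {q \<in> ?A. q < p}"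
        using A(2) by (auto simp: not_le)
      ultimately show ?thesis by simp
    qed
    ultimately show ?thesis
      using True card p_le by (simp add: u_def v_def)
  qed
qed

section \<open>Matching trees and the listed equivalences\<close>

lemma insertion_112_212:
  "smallest_letter_insertion (\<lambda>w. \<forall>\<rho>\<in>{[1,1,2], [2,1,2]}. avoids w \<rho>) (\<lambda>a. 1) (\<lambda>a. a - 1)
     (\<lambda>u v. set u \<inter> set v = {}) (\<lambda>a n r. if a = 1 then n + 1 else r + 1)"
proof (rule insertion_avoiding_112I, goal_cases)
  case (4 i a u v)
  then show ?case
    using avoids_112_surround[of u v i 1 "a - 1"] avoids_212_surround[of u v i 1 "a - 1"] by auto
next
  case (5 i a w)
  then show ?case
    by (rule rank_exists_disjoint)
qed (simp_all add: avoids_Nil)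

lemma insertion_121_122:
  "smallest_letter_insertion (\<lambda>w. \<forall>\<rho>\<in>{[1,2,1], [1,2,2]}. avoids w \<rho>) (\<lambda>a. a) (\<lambda>a. 0)
     (\<lambda>u v. distinct v) (\<lambda>a n r. if a = 1 then n + 1 else r + 1)"
proof (rule insertion_avoiding_121I, goal_cases)
  case (4 i a u v)
  then show ?case
    using avoids_121_surround[of u v i a 0] avoids_122_surround[of u v i a 0] by auto
next
  case (5 i a w)
  then show ?case
    by (rule rank_exists_distinct)
qed (simp_all add: avoids_Nil)

lemma insertion_121_123:
  "smallest_letter_insertion (\<lambda>w. \<forall>\<rho>\<in>{[1,2,1], [1,2,3]}. avoids w \<rho>) (\<lambda>a. a) (\<lambda>a. 0)
     (\<lambda>u v. sorted_wrt (\<ge>) v) (\<lambda>a n r. if r = n then n + a else r + 1)"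
proof (rule insertion_avoiding_121I, goal_cases)
  case (4 i a u v)
  then show ?case
    using avoids_121_surround[of u v i a 0] avoids_123_surround[of u v i a 0] by auto
next
  case (5 i a w)
  then show ?case
    by (rule rank_exists_decreasing)
qed (simp_all add: avoids_Nil)

lemma insertion_121_213:
  "smallest_letter_insertion (\<lambda>w. \<forall>\<rho>\<in>{[1,2,1], [2,1,3]}. avoids w \<rho>) (\<lambda>a. a) (\<lambda>a. 0)
     (\<lambda>u v. \<forall>y\<in>set u. \<forall>z\<in>set v. z \<le> y) (\<lambda>a n r. if r = n then n + a else r + 1)"
proof (rule insertion_avoiding_121I, goal_cases)
  case (4 i a u v)
  then show ?case
    using avoids_121_surround[of u v i a 0] avoids_213_surround[of u v i a 0] by auto
next
  case (5 i a w)
  then show ?case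
    by (rule rank_exists_dominating)
qed (simp_all add: avoids_Nil)

lemma m_equivalent_if_insertion:
  assumes "smallest_letter_insertion (\<lambda>w. \<forall>\<rho>\<in>P. avoids w \<rho>) nb na ok child"
    and "smallest_letter_insertion (\<lambda>w. \<forall>\<rho>\<in>Q. avoids w \<rho>) nb' na' ok' child"
  shows "P \<sim>\<^sub>m Q"
  using card_good_words_eq[OF assms] by (simp add: m_equivalent_def av_def good_words_def)

lemma m_equivalent_111_112_111_121: "{[1,1,1], [1,1,2]} \<sim>\<^sub>m {[1,1,1], [1,2,1]}"
  by (intro m_equivalent_insert_111 m_equivalent_if_insertion[OF insertion_112 insertion_121])

lemma m_equivalent_listed:
  assumes "(P, Q) \<in> listed_relations"
  shows "P \<sim>\<^sub>m Q"
proof -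
  have "{[1,1,1], [1,2,3]} \<sim>\<^sub>m {[1,1,1], [1,3,2]}"
    by (intro m_equivalent_insert_111 m_equivalent_123_132)
  moreover have "{[1,1,1], [1,3,2]} \<sim>\<^sub>m {[1,1,1], [2,1,3]}"
    using m_equivalent_123_132 m_equivalent_123_213 m_equivalent_sym m_equivalent_trans
    by (intro m_equivalent_insert_111) blast
  moreover have "{[1,1,2], [2,1,3]} \<sim>\<^sub>m {[1,2,1], [1,3,2]}"
    using m_equivalent_112_123_112_213 unfolding m_equivalent_def av_112_123_121_132 by simp
  moreover have "{[1,1,2], [2,1,2]} \<sim>\<^sub>m {[1,2,1], [1,2,2]}"
    by (rule m_equivalent_if_insertion[OF insertion_112_212 insertion_121_122])
  moreover have "{[1,2,1], [1,2,3]} \<sim>\<^sub>m {[1,2,1], [2,1,3]}"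
    by (rule m_equivalent_if_insertion[OF insertion_121_123 insertion_121_213])
  ultimately show ?thesis
    using assms m_equivalent_111_112_111_121 m_equivalent_112_123_112_213
    unfolding listed_relations_def by blast
qed

section \<open>Completeness of the list\<close>

text \<open>Computable counterpart of \<open>same_order\<close>, for evaluating the finite
  tables.\<close>

fun same_order3 :: "word \<Rightarrow> word \<Rightarrow> bool" where
  "same_order3 [x, y, z] [p, q, r] \<longleftrightarrow>
     (x < y \<longleftrightarrow> p < q) \<and> (y < x \<longleftrightarrow> q < p) \<and> (x < z \<longleftrightarrow> p < r) \<and>
     (z < x \<longleftrightarrow> r < p) \<and> (y < z \<longleftrightarrow> q < r) \<and> (z < y \<longleftrightarrow> r < q)"
| "same_order3 u \<rho> \<longleftrightarrow> False"

lemma same_order3_iff: "length \<rho> = 3 \<Longrightarrow> same_order3 u \<rho> \<longleftrightarrow> same_order u \<rho>"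
proof -
  assume "length \<rho> = 3"
  then obtain p q r where "\<rho> = [p, q, r]"
    by (auto simp: numeral_3_eq_3 length_Suc_conv)
  moreover have "same_order3 u [p, q, r] \<longleftrightarrow> same_order u [p, q, r]"
    by (cases "(u, [p, q, r])" rule: same_order3.cases) (simp_all add: same_order_length3)
  ultimately show ?thesis
    by simp
qed

definition contained_patterns :: "word \<Rightarrow> word list" where
  "contained_patterns w =
     filter (\<lambda>\<rho>. list_ex (\<lambda>u. same_order3 u \<rho>) (filter (\<lambda>u. length u = 3) (subseqs w))) pattern_list"

text \<open>The patterns contained in each multipermutation are determined once; every pair of
  patterns then only filters this table.\<close>

definition profile :: "nat list \<Rightarrow> word list list" where
  "profile xs = map contained_patterns (permutations_of_list_impl xs)"

definition count_avoiding :: "word list list \<Rightarrow> word \<Rightarrow> word \<Rightarrow> nat" where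
  "count_avoiding cs p q = length (filter (\<lambda>ps. p \<notin> set ps \<and> q \<notin> set ps) cs)"

text \<open>
  One pair of patterns from each of the 32 classes, with the numbers of multipermutations of
  \<open>1 2 3\<^sup>2 4\<close>, \<open>1\<^sup>2 2\<^sup>2 3\<close> and \<open>1 2\<^sup>3 3\<close> avoiding the pair; these triples are pairwise distinct.
\<close>

definition representatives :: "((word \<times> word) \<times> nat \<times> nat \<times> nat) list" where
  "representatives =
    [(([1,1,1], [1,1,2]), (40, 8, 0)), (([1,1,1], [1,2,2]), (30, 15, 0)),
     (([1,1,1], [1,2,3]), (28, 19, 0)), (([1,1,2], [1,2,1]), (20, 1, 5)),
     (([1,1,2], [1,2,2]), (18, 5, 4)), (([1,1,2], [1,2,3]), (23, 7, 9)),
     (([1,1,2], [1,3,2]), (14, 5, 7)), (([1,1,2], [2,1,1]), (20, 1, 0)),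
     (([1,1,2], [2,1,2]), (18, 5, 5)), (([1,1,2], [2,2,1]), (24, 0, 6)),
     (([1,1,2], [2,3,1]), (19, 4, 7)), (([1,1,2], [3,1,2]), (14, 5, 5)),
     (([1,1,2], [3,2,1]), (14, 0, 5)), (([1,2,1], [1,2,3]), (19, 6, 7)),
     (([1,2,1], [2,1,2]), (24, 6, 6)), (([1,2,2], [1,2,3]), (19, 12, 9)),
     (([1,2,2], [2,1,2]), (10, 5, 5)), (([1,2,2], [2,1,3]), (12, 7, 7)),
     (([1,2,2], [2,2,1]), (10, 5, 0)), (([1,2,2], [2,3,1]), (12, 7, 5)),
     (([1,2,2], [3,1,2]), (10, 10, 7)), (([1,2,2], [3,2,1]), (9, 9, 5)),
     (([1,2,3], [1,3,2]), (15, 12, 11)), (([1,2,3], [2,1,2]), (16, 10, 7)),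
     (([1,2,3], [2,1,3]), (14, 14, 11)), (([1,2,3], [2,3,1]), (10, 12, 8)),
     (([1,2,3], [3,1,2]), (10, 9, 8)), (([1,2,3], [3,2,1]), (4, 9, 8)),
     (([1,3,2], [2,1,3]), (14, 12, 11)), (([1,3,2], [2,3,1]), (12, 12, 8)),
     (([1,3,2], [3,1,2]), (13, 12, 8)), (([2,1,3], [3,1,2]), (12, 9, 8))]"

lemma in_contained_patterns_iff:
  "\<rho> \<in> set (contained_patterns w) \<longleftrightarrow> \<rho> \<in> set pattern_list \<and> contains_pattern w \<rho>"
proof (cases "\<rho> \<in> set pattern_list")
  case True
  then have "length \<rho> = 3"
    by (auto simp: pattern_list_def)
  then have "same_order3 u \<rho> \<longleftrightarrow> same_order u \<rho>" "same_order u \<rho> \<Longrightarrow> length u = 3" for u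
    by (auto simp: same_order3_iff same_order_def)
  then show ?thesis
    using True
    by (auto simp: contained_patterns_def contains_pattern_iff_subseq list_ex_iff)
qed (simp add: contained_patterns_def)

lemma av_eq_count_avoiding:
  assumes "p \<in> set pattern_list" "q \<in> set pattern_list"
  shows "av (mset xs) {p, q} = count_avoiding (profile xs) p q"
proof -
  let ?ws = "filter (\<lambda>w. avoids w p \<and> avoids w q) (permutations_of_list_impl xs)"
  have "count_avoiding (profile xs) p q = length ?ws"
    using assms
    by (simp add: count_avoiding_def profile_def filter_map o_def in_contained_patterns_iff)
  also have "\<dots> = card (set ?ws)"
    by (rule distinct_card[symmetric]) (simp add: distinct_permutations_of_list_impl)
  also have "set ?ws = {w \<in> permutations_of_multiset (mset xs). \<forall>\<rho>\<in>{p, q}. avoids w \<rho>}"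
    by (auto simp: set_permutations_of_list_impl)
  finally show ?thesis
    by (simp add: av_def)
qed

definition signature :: "word \<Rightarrow> word \<Rightarrow> nat \<times> nat \<times> nat" where
  "signature p q =
     (count_avoiding (profile [1,2,3,3,4]) p q, count_avoiding (profile [1,1,2,2,3]) p q,
      count_avoiding (profile [1,2,2,2,3]) p q)"

lemma signature_eq_if_m_equivalent:
  assumes "{p, q} \<sim>\<^sub>m {p', q'}" "set [p, q, p', q'] \<subseteq> set pattern_list"
  shows "signature p q = signature p' q'"
proof -
  have "reduced (mset xs)" if "set xs = {1..k}" "k \<ge> 1" for xs k
    using that by (auto simp: reduced_def)
  moreover have "set [1,2,3,3,4] = {1..4::nat}" "set [1,1,2,2,3] = {1..3::nat}"
    "set [1,2,2,2,3] = {1..3::nat}"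
    by auto
  ultimately have "reduced (mset [1,2,3,3,4])" "reduced (mset [1,1,2,2,3])"
    "reduced (mset [1,2,2,2,3])"
    by (metis one_le_numeral)+
  then show ?thesis
    using assms unfolding signature_def m_equivalent_def
    by (simp only: av_eq_count_avoiding[symmetric] list.set insert_subset)
qed

lemma signature_representatives:
  "map (\<lambda>((p, q), s). signature p q) representatives = map snd representatives"
proof -
  \<comment> \<open>The abstraction makes the simplifier evaluate each profile only once.\<close>
  have "(\<lambda>(c1, c2, c3). map (\<lambda>((p, q), s).
      (count_avoiding c1 p q, count_avoiding c2 p q, count_avoiding c3 p q)) representatives)
    (profile [1,2,3,3,4], profile [1,1,2,2,3], profile [1,2,2,2,3]) = map snd representatives"
    by code_simp
  then show ?thesis
    by (simp only: signature_def prod.case)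
qed

text \<open>Equivalent pairs share their signature, and no signature occurs twice in the
  table.\<close>

lemma representatives_eq_if_m_equivalent:
  assumes "x \<in> fst ` set representatives" "y \<in> fst ` set representatives"
    and "{fst x, snd x} \<sim>\<^sub>m {fst y, snd y}"
  shows "x = y"
proof -
  obtain s t where st: "(x, s) \<in> set representatives" "(y, t) \<in> set representatives"
    using assms(1,2) by auto
  have sig: "signature (fst z) (snd z) = r" if "(z, r) \<in> set representatives" for z r
    using bspec[OF signature_representatives[unfolded map_eq_conv] that] by (cases z) simp
  have "\<forall>e\<in>set representatives. fst (fst e) \<in> set pattern_list \<and> snd (fst e) \<in> set pattern_list"
    by code_simp
  from bspec[OF this st(1)] bspec[OF this st(2)]
  have "set [fst x, snd x, fst y, snd y] \<subseteq> set pattern_list"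
    by simp
  with assms(3) have "s = t"
    using signature_eq_if_m_equivalent[of "fst x" "snd x" "fst y" "snd y"] sig[OF st(1)] sig[OF st(2)]
    by simp
  moreover have "distinct (map snd representatives)"
    by code_simp
  ultimately show ?thesis
    using st inj_onD[of snd "set representatives" "(x, s)" "(y, t)"] by (simp add: distinct_map)
qed

section \<open>Connecting every pair to a representative\<close>

definition listed_pairs :: "((word \<times> word) \<times> (word \<times> word)) list" where
  "listed_pairs =
    [(([1,1,1], [1,2,3]), ([1,1,1], [1,3,2])),
     (([1,1,1], [1,3,2]), ([1,1,1], [2,1,3])),
     (([1,1,1], [1,1,2]), ([1,1,1], [1,2,1])),
     (([1,1,2], [1,2,3]), ([1,1,2], [2,1,3])),
     (([1,1,2], [2,1,3]), ([1,2,1], [1,3,2])),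
     (([1,1,2], [2,1,2]), ([1,2,1], [1,2,2])),
     (([1,2,1], [1,2,3]), ([1,2,1], [2,1,3]))]"

fun complement_pair :: "word \<times> word \<Rightarrow> word \<times> word" where
  "complement_pair (p, q) = (complement p, complement q)"

text \<open>The steps that the list, complementation and symmetry force on every admissible
  relation. Complementing once more would only return to the list.\<close>

definition edges :: "((word \<times> word) \<times> (word \<times> word)) list" where
  "edges = (let es = listed_pairs @ map (map_prod complement_pair complement_pair) listed_pairs
     in es @ map prod.swap es)"

text \<open>Ordered pairs stand for two-element sets, hence the exchange of the components.\<close>

fun variants :: "word \<times> word \<Rightarrow> (word \<times> word) list" where
  "variants (p, q) = [(p, q), (q, p), (rev p, rev q), (rev q, rev p)]"

text \<open>The starting point \<open>x\<close> is included so that a fixed number of steps also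
  covers shorter paths.\<close>

definition neighbours ::
  "((word \<times> word) \<times> (word \<times> word)) list \<Rightarrow> word \<times> word \<Rightarrow> (word \<times> word) list" where
  "neighbours es x = x # map snd (filter (\<lambda>e. fst e = x) es)"

text \<open>Chains in the list have at most two links, which suggests two steps; the evaluation
  confirms that reversal at the two ends of the path suffices.\<close>

lemma path_to_representative:
  assumes "p \<in> set pattern_list" "q \<in> set pattern_list" "p \<noteq> q"
  shows "\<exists>v\<in>set (variants (p, q)). \<exists>x\<in>set (neighbours edges v). \<exists>y\<in>set (neighbours edges x).
    \<exists>z\<in>set (variants y). z \<in> fst ` set representatives"
proof -
  have "(\<lambda>(es, zs). \<forall>p\<in>set pattern_list. \<forall>q\<in>set pattern_list. p \<noteq> q \<longrightarrow>
      (\<exists>v\<in>set (variants (p, q)). \<exists>x\<in>set (neighbours es v). \<exists>y\<in>set (neighbours es x).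
        \<exists>z\<in>set (variants y). z \<in> set zs)) (edges, map fst representatives)"
    by code_simp
  then show ?thesis
    using assms by simp
qed

lemma listed_relations_eq:
  "listed_relations = (\<lambda>(x, y). ({fst x, snd x}, {fst y, snd y})) ` set listed_pairs"
  by (simp add: listed_relations_def listed_pairs_def)

lemma pattern_pairs_iff:
  "P \<in> pattern_pairs \<longleftrightarrow> (\<exists>p\<in>set pattern_list. \<exists>q\<in>set pattern_list. p \<noteq> q \<and> P = {p, q})"
  unfolding pattern_pairs_def patterns3_eq[symmetric] by (auto simp: card_2_iff)

lemma rev_pattern_pairs: "P \<in> pattern_pairs \<Longrightarrow> rev ` P \<in> pattern_pairs"
proof -
  have "rev \<rho> \<in> patterns3" if "\<rho> \<in> patterns3" for \<rho>
    using that unfolding patterns3_def by (auto simp: permutations_of_multiset_def)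
  then show "P \<in> pattern_pairs \<Longrightarrow> rev ` P \<in> pattern_pairs"
    unfolding pattern_pairs_def by (auto simp: card_image inj_on_def)
qed

lemma complement_pattern_pairs: "P \<in> pattern_pairs \<Longrightarrow> complement ` P \<in> pattern_pairs"
proof -
  have "inj_on complement patterns3"
    by (rule inj_on_inverseI[of _ complement]) (rule complement_patterns)
  then show "P \<in> pattern_pairs \<Longrightarrow> complement ` P \<in> pattern_pairs"
    unfolding pattern_pairs_def using complement_patterns(1)
    by (auto simp: card_image inj_on_subset)
qed

lemma listed_relations_pattern_pairs: "listed_relations \<subseteq> pattern_pairs \<times> pattern_pairs"
proof -
  have "\<forall>(x, y)\<in>set listed_pairs. \<forall>(p, q)\<in>{x, y}. p \<in> set pattern_list \<and> q \<in> set pattern_list \<and> p \<noteq> q"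
    by code_simp
  then show ?thesis
    unfolding listed_relations_eq by (fastforce simp: pattern_pairs_iff)
qed

lemma admissible_m_equivalence: "admissible m_equivalence_on_pairs"
  unfolding admissible_def
proof (intro conjI)
  show "equiv pattern_pairs m_equivalence_on_pairs"
    by (intro equivI refl_onI symI transI)
      (auto simp: m_equivalence_on_pairs_def intro: m_equivalent_sym m_equivalent_trans)
  show "listed_relations \<subseteq> m_equivalence_on_pairs"
    using listed_relations_pattern_pairs m_equivalent_listed
    by (auto simp: m_equivalence_on_pairs_def)
  show "\<forall>P\<in>pattern_pairs. (P, rev ` P) \<in> m_equivalence_on_pairs"
    by (simp add: m_equivalence_on_pairs_def rev_pattern_pairs m_equivalent_rev)
  show "\<forall>P Q. (P, Q) \<in> m_equivalence_on_pairs \<longrightarrow>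
      (complement ` P, complement ` Q) \<in> m_equivalence_on_pairs"
  proof (intro allI impI)
    fix P Q assume "(P, Q) \<in> m_equivalence_on_pairs"
    then have PQ: "P \<in> pattern_pairs" "Q \<in> pattern_pairs" "P \<sim>\<^sub>m Q"
      by (auto simp: m_equivalence_on_pairs_def)
    then have "P \<subseteq> patterns3" "Q \<subseteq> patterns3"
      by (auto simp: pattern_pairs_def)
    then show "(complement ` P, complement ` Q) \<in> m_equivalence_on_pairs"
      using PQ by (simp add: m_equivalence_on_pairs_def m_equivalent_complement complement_pattern_pairs)
  qed
qed

lemma
  assumes "admissible R"
  shows admissible_refl: "P \<in> pattern_pairs \<Longrightarrow> (P, P) \<in> R"
    and admissible_sym: "(P, Q) \<in> R \<Longrightarrow> (Q, P) \<in> R"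
    and admissible_trans: "(P, Q) \<in> R \<Longrightarrow> (Q, P') \<in> R \<Longrightarrow> (P, P') \<in> R"
    and admissible_pattern_pairs: "(P, Q) \<in> R \<Longrightarrow> P \<in> pattern_pairs \<and> Q \<in> pattern_pairs"
    and admissible_listed: "(P, Q) \<in> listed_relations \<Longrightarrow> (P, Q) \<in> R"
    and admissible_rev: "P \<in> pattern_pairs \<Longrightarrow> (P, rev ` P) \<in> R"
    and admissible_complement: "(P, Q) \<in> R \<Longrightarrow> (complement ` P, complement ` Q) \<in> R"
  using assms unfolding admissible_def equiv_def refl_on_def sym_def trans_def by blast+

lemma edges_admissible:
  assumes R: "admissible R" and "(x, y) \<in> set edges"
  shows "({fst x, snd x}, {fst y, snd y}) \<in> R"
proof -
  have listed: "({fst x, snd x}, {fst y, snd y}) \<in> R" if "(x, y) \<in> set listed_pairs" for x y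
    using that by (intro admissible_listed[OF R]) (force simp: listed_relations_eq)
  have complement: "({fst x, snd x}, {fst y, snd y}) \<in> R"
    if xy: "(x, y) \<in> set (map (map_prod complement_pair complement_pair) listed_pairs)" for x y
  proof -
    obtain x' y' where "(x', y') \<in> set listed_pairs" "x = complement_pair x'" "y = complement_pair y'"
      using xy by (auto simp del: complement_pair.simps)
    then show ?thesis
      using admissible_complement[OF R listed, of x' y'] by (cases x'; cases y') simp
  qed
  define es where "es = listed_pairs @ map (map_prod complement_pair complement_pair) listed_pairs"
  have es: "({fst x, snd x}, {fst y, snd y}) \<in> R" if "(x, y) \<in> set es" for x y
    using that listed complement unfolding es_def set_append by blast
  have edges: "edges = es @ map prod.swap es"
    by (simp add: edges_def es_def Let_def)
  have "(x, y) \<in> set es \<or> (y, x) \<in> set es"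
    using assms(2) unfolding edges by auto
  then show ?thesis
    using es admissible_sym[OF R] by blast
qed

lemma variants_admissible:
  assumes R: "admissible R" and "{fst x, snd x} \<in> pattern_pairs" "y \<in> set (variants x)"
  shows "({fst x, snd x}, {fst y, snd y}) \<in> R"
proof -
  have "{fst y, snd y} = {fst x, snd x} \<or> {fst y, snd y} = rev ` {fst x, snd x}"
    using assms(3) by (cases x) auto
  then show ?thesis
    using admissible_refl[OF R assms(2)] admissible_rev[OF R assms(2)] by auto
qed

lemma neighbours_admissible:
  assumes R: "admissible R" and "{fst x, snd x} \<in> pattern_pairs" "y \<in> set (neighbours edges x)"
  shows "({fst x, snd x}, {fst y, snd y}) \<in> R"
proof -
  have "y = x \<or> (x, y) \<in> set edges"
    using assms(3) by (auto simp: neighbours_def)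
  then show ?thesis
    using admissible_refl[OF R assms(2)] edges_admissible[OF R, of x y] by blast
qed

text \<open>The path uses only steps that admissibility enforces, so the same computation serves
  every admissible relation.\<close>

lemma admissible_representative:
  assumes R: "admissible R" and "P \<in> pattern_pairs"
  obtains z where "z \<in> fst ` set representatives" "(P, {fst z, snd z}) \<in> R"
proof -
  obtain p q where pq: "p \<in> set pattern_list" "q \<in> set pattern_list" "p \<noteq> q" "P = {p, q}"
    using assms(2) by (auto simp: pattern_pairs_iff)
  from path_to_representative[OF pq(1-3)] obtain v x y z where
    v: "v \<in> set (variants (p, q))" and x: "x \<in> set (neighbours edges v)"
    and y: "y \<in> set (neighbours edges x)" and z: "z \<in> set (variants y)"
    and rep: "z \<in> fst ` set representatives"
    by blast
  have v_R: "(P, {fst v, snd v}) \<in> R"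
    using variants_admissible[OF R _ v] assms(2) pq(4) by simp
  have x_R: "({fst v, snd v}, {fst x, snd x}) \<in> R"
    using neighbours_admissible[OF R _ x] admissible_pattern_pairs[OF R v_R] by simp
  have y_R: "({fst x, snd x}, {fst y, snd y}) \<in> R"
    using neighbours_admissible[OF R _ y] admissible_pattern_pairs[OF R x_R] by simp
  have "({fst y, snd y}, {fst z, snd z}) \<in> R"
    using variants_admissible[OF R _ z] admissible_pattern_pairs[OF R y_R] by simp
  then have "(P, {fst z, snd z}) \<in> R"
    using v_R x_R y_R admissible_trans[OF R] by metis
  with rep show thesis
    by (rule that)
qed

text \<open>Admissibility is a closure condition inside the square of \<open>pattern_pairs\<close>,
  and such conditions pass to intersections.\<close>

lemma admissible_Int:
  assumes R: "admissible R" and R': "admissible R'"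
  shows "admissible (R \<inter> R')"
  unfolding admissible_def
proof (intro conjI)
  note facts = admissible_refl admissible_sym admissible_trans admissible_listed admissible_rev
    admissible_complement
  note RR' = facts[OF R] facts[OF R'] admissible_pattern_pairs[OF R]
  show "equiv pattern_pairs (R \<inter> R')"
  proof (rule equivI)
    show "refl_on pattern_pairs (R \<inter> R')"
      unfolding refl_on_def using RR'(1,7) by blast
    show "sym (R \<inter> R')"
      unfolding sym_def using RR'(2,8) by blast
    show "trans (R \<inter> R')"
      unfolding trans_def using RR'(3,9) by blast
    show "R \<inter> R' \<subseteq> pattern_pairs \<times> pattern_pairs"
      using RR'(13) by auto
  qed
  show "listed_relations \<subseteq> R \<inter> R'"
    using RR'(4,10) by auto
  show "\<forall>P\<in>pattern_pairs. (P, rev ` P) \<in> R \<inter> R'"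
    using RR'(5,11) by blast
  show "\<forall>P Q. (P, Q) \<in> R \<inter> R' \<longrightarrow> (complement ` P, complement ` Q) \<in> R \<inter> R'"
    using RR'(6,12) by blast
qed

text \<open>An equivalence \<open>P \<sim>\<^sub>m Q\<close> passes to the representatives of
  \<open>P\<close> and \<open>Q\<close>, which therefore coincide; \<open>R\<close> then relates
  \<open>P\<close> and \<open>Q\<close> through this common representative.\<close>

lemma m_equivalence_subset_admissible:
  assumes R: "admissible R"
  shows "m_equivalence_on_pairs \<subseteq> R"
proof (rule subrelI)
  fix P Q assume "(P, Q) \<in> m_equivalence_on_pairs"
  then have PQ: "P \<in> pattern_pairs" "Q \<in> pattern_pairs" "P \<sim>\<^sub>m Q"
    by (auto simp: m_equivalence_on_pairs_def)
  \<comment> \<open>The representatives may be chosen to work for \<open>R\<close> and for \<open>m\<close>-equivalence simultaneously.\<close>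
  have R': "admissible (R \<inter> m_equivalence_on_pairs)"
    using R admissible_m_equivalence by (rule admissible_Int)
  obtain x where x: "x \<in> fst ` set representatives" "(P, {fst x, snd x}) \<in> R \<inter> m_equivalence_on_pairs"
    using admissible_representative[OF R' PQ(1)] .
  obtain y where y: "y \<in> fst ` set representatives" "(Q, {fst y, snd y}) \<in> R \<inter> m_equivalence_on_pairs"
    using admissible_representative[OF R' PQ(2)] .
  have "{fst x, snd x} \<sim>\<^sub>m {fst y, snd y}"
    using x(2) y(2) PQ(3) unfolding m_equivalence_on_pairs_def m_equivalent_def by simp
  then have "x = y"
    by (rule representatives_eq_if_m_equivalent[OF x(1) y(1)])
  then show "(P, Q) \<in> R"
    using x(2) y(2) admissible_sym[OF R] admissible_trans[OF R] by blast
qed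

theorem mainTheorem16:
  shows
    "({[1,1,1], [1,2,3]} \<sim>\<^sub>m {[1,1,1], [1,3,2]} \<and> {[1,1,1], [1,3,2]} \<sim>\<^sub>m {[1,1,1], [2,1,3]}) \<and>
     {[1,1,1], [1,1,2]} \<sim>\<^sub>m {[1,1,1], [1,2,1]} \<and>
     ({[1,1,2], [1,2,3]} \<sim>\<^sub>m {[1,1,2], [2,1,3]} \<and> {[1,1,2], [2,1,3]} \<sim>\<^sub>m {[1,2,1], [1,3,2]}) \<and>
     {[1,1,2], [2,1,2]} \<sim>\<^sub>m {[1,2,1], [1,2,2]} \<and>
     {[1,2,1], [1,2,3]} \<sim>\<^sub>m {[1,2,1], [2,1,3]} \<and>
     admissible m_equivalence_on_pairs \<and>
     (\<forall>R. admissible R \<longrightarrow> m_equivalence_on_pairs \<subseteq> R)"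
proof (intro conjI allI impI)
  show "admissible m_equivalence_on_pairs"
    by (rule admissible_m_equivalence)
  show "m_equivalence_on_pairs \<subseteq> R" if "admissible R" for R
    using that by (rule m_equivalence_subset_admissible)
qed (rule m_equivalent_listed, unfold listed_relations_def, (rule insertI1 | rule insertI2)+)+

end
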